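(* There is an absolute constant $c>0$ such that the following holds. Let $k\ge2$, $n\ge1$ and $\mathfrak{s}=[s_1,\ldots,s_k]$ with integers $s_i\ge1$ and $\sum_i s_i\le n/2$. Let $\Pi$ be a $[c_1,\ldots,c_k]$-bounded $k$-party protocol (deterministic, or randomized with public/private coins) which solves unique set-disjointness under input distribution $\mathcal{D}_{\mathfrak{s}}$ with error at most $1\%$. Then $\sum_{i\in[k]} c_i/s_i\ge c$.
   Context: Inputs are $X=(X_1,\ldots,X_k)\in(\{0,1\}^n)^k$ (sets via indicator vectors, $|X_i|$ the set size); $X^j=(X_1(j),\ldots,X_k(j))$; $\mathcal{F}_0=\{X:\forall j,|X^j|\le1\}$, $\mathcal{F}_1=\{X:\exists j,|X^j|=k,\forall j'\ne j,|X^{j'}|\le1\}$. $\mathcal{F}^b_{\mathfrak{s}}=\mathcal{F}_b\cap\{X:|X_i|=s_i\ \forall i\}$, $\mathcal{D}^b_{\mathfrak{s}}$ is the uniform distribution on $\mathcal{F}^b_{\mathfrak{s}}$, and $\mathcal{D}_{\mathfrak{s}}$ samples a uniform bit $b$ then $X\sim\mathcal{D}^b_{\mathfrak{s}}$; error is the probability the output differs from $b$. Protocols are in the blackboard model; $[c_1,\ldots,c_k]$-bounded means player $i$ writes at most $c_i$ bits in every transcript. *)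

theory Defs
  imports "HOL-Probability.Probability_Mass_Function"
begin

definition inputs :: "nat \<Rightarrow> nat \<Rightarrow> (nat \<Rightarrow> nat set) set" where
  "inputs k n = {X. (\<forall>i<k. X i \<subseteq> {0..<n}) \<and> (\<forall>i\<ge>k. X i = {})}"

definition col :: "nat \<Rightarrow> (nat \<Rightarrow> nat set) \<Rightarrow> nat \<Rightarrow> nat" where
  "col k X j = card {i\<in>{0..<k}. j \<in> X i}"

definition F0 :: "nat \<Rightarrow> nat \<Rightarrow> (nat \<Rightarrow> nat set) set" where
  "F0 k n = {X \<in> inputs k n. \<forall>j<n. col k X j \<le> 1}"

definition F1 :: "nat \<Rightarrow> nat \<Rightarrow> (nat \<Rightarrow> nat set) set" where
  "F1 k n = {X \<in> inputs k n. \<exists>j<n. col k X j = k \<and> (\<forall>j'<n. j' \<noteq> j \<longrightarrow> col k X j' \<le> 1)}"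

definition Fs :: "bool \<Rightarrow> nat \<Rightarrow> nat \<Rightarrow> (nat \<Rightarrow> nat) \<Rightarrow> (nat \<Rightarrow> nat set) set" where
  "Fs b k n s = {X \<in> (if b then F1 k n else F0 k n). \<forall>i<k. card (X i) = s i}"

text \<open>Deterministic blackboard protocols as protocol trees: at a node, the
  speaker i writes one bit which is a function of its own input X i; the
  speaker and the function may depend on the transcript so far (position in the tree).
  Leaves carry the output bit (True = 1).\<close>
datatype proto = Leaf bool | Node nat "nat set \<Rightarrow> bool" proto proto

fun run :: "proto \<Rightarrow> (nat \<Rightarrow> nat set) \<Rightarrow> bool" where
  "run (Leaf b) X = b"
| "run (Node i f t0 t1) X = (if f (X i) then run t1 X else run t0 X)"

fun bits :: "proto \<Rightarrow> (nat \<Rightarrow> nat set) \<Rightarrow> nat \<Rightarrow> nat" where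
  "bits (Leaf b) X j = 0"
| "bits (Node i f t0 t1) X j =
     (if i = j then 1 else 0) + (if f (X i) then bits t1 X j else bits t0 X j)"

definition bounded :: "nat \<Rightarrow> nat \<Rightarrow> (nat \<Rightarrow> nat) \<Rightarrow> proto \<Rightarrow> bool" where
  "bounded k n c P \<longleftrightarrow> (\<forall>X\<in>inputs k n. \<forall>j. bits P X j \<le> (if j < k then c j else 0))"

text \<open>Randomized (public/private coin) protocol = probability distribution over
  deterministic protocols; deterministic ones are return_pmf P.
  Error under D_s: b uniform, X uniform on F^b_s.\<close>
definition dist_error :: "nat \<Rightarrow> nat \<Rightarrow> (nat \<Rightarrow> nat) \<Rightarrow> proto pmf \<Rightarrow> real" where
  "dist_error k n s R = (1/2) * (\<Sum>b\<in>(UNIV::bool set).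
      (\<Sum>X\<in>Fs b k n s. measure_pmf.prob R {P. run P X \<noteq> b}) / real (card (Fs b k n s)))"

end

(*
Symmetrise by a random relabelling of the coordinates. Give player i a list of s_i disjoint pairs
of points and one point of each pair; all players' first pairs share one point. The bit of player i
says whether it takes the shared point: if all bits are 0 the input is uniform on F^0, if all are 1
it is uniform on F^1, and given the bits the players are independent.

For a set B of players let v_B be the vector of square roots of the transcript probabilities when
exactly the players in B have bit 1. Cut-and-paste gives v_A v_B = v_{A Un B} v_{} pointwise for
disjoint A, B, so |v_A - v_B| = |v_{A Un B} - v_{}|; merging blocks of players two at a time yields
|v_{all} - v_{}|^2 <= e^2 sum_i |v_{i} - v_{}|^2. A small error makes the left side large. On the
right, the first pair of player i is exchangeable with its other pairs, and the sum over all pairs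
is at most a constant times the number of bits player i writes, by the level-one inequality on the
cube and Kraft's inequality. Hence the i-th term is O(c_i / s_i) on average.
*)

theory Submission
  imports Defs "HOL-Probability.Product_PMF" "HOL-Combinatorics.Permutations"
begin

section \<open>The level-one inequality\<close>

lemma cosh_le_exp_square:
  fixes x :: real
  assumes "\<bar>x\<bar> \<le> 1"
  shows "cosh x \<le> exp (x\<^sup>2)"
proof -
  have pos: "cosh y \<le> exp (y\<^sup>2)" if y: "0 \<le> y" "y \<le> 1" for y :: real
  proof -
    have "exp (-y) * (1 + y) \<le> exp (-y) * exp y"
      by (intro mult_left_mono) auto
    also have "\<dots> = 1" by (simp flip: exp_add)
    \<comment> \<open>The product equals \<open>1 + y ^ 3\<close>.\<close>
    also have "1 \<le> (1 - y + y\<^sup>2) * (1 + y)"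
      using y by (simp add: algebra_simps power2_eq_square)
    finally have "exp (-y) \<le> 1 - y + y\<^sup>2"
      using y by (simp add: mult_le_cancel_right)
    moreover have "exp y \<le> 1 + y + y\<^sup>2"
      using y by (rule exp_bound)
    ultimately have "cosh y \<le> 1 + y\<^sup>2"
      by (simp add: cosh_field_def)
    also have "\<dots> \<le> exp (y\<^sup>2)" by simp
    finally show ?thesis .
  qed
  show ?thesis
    using pos[of x] pos[of "-x"] assms by (cases "0 \<le> x") auto
qed

text \<open>Compare the mean of \<open>exp (\<Sum>l. \<delta> l / 2 * sg l y)\<close> over \<open>\<A>\<close>, bounded below
  by convexity, with its mean over the whole cube, where it factorises into \<open>cosh\<close>s.\<close>

lemma level_one_inequality:
  fixes \<A> :: "nat set set"
  assumes sub: "\<A> \<subseteq> Pow {..<m}" and ne: "\<A> \<noteq> {}"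
  defines "sg \<equiv> \<lambda>l y. if l \<in> y then 1 else (-1 :: real)"
  defines "\<delta> \<equiv> \<lambda>l. (\<Sum>y\<in>\<A>. sg l y) / card \<A>"
  shows "(\<Sum>l<m. (\<delta> l)\<^sup>2) \<le> 4 * ln (2 ^ m / card \<A>)"
proof -
  have fin: "finite \<A>" using sub by (rule finite_subset) auto
  then have pos: "real (card \<A>) > 0" using ne by (simp add: card_gt_0_iff)
  define D where "D = (\<Sum>l<m. (\<delta> l)\<^sup>2)"
  \<comment> \<open>Weights \<open>t * \<delta> l\<close> would give the competing bounds
    \<open>exp (t * D)\<close> and \<open>exp (t\<^sup>2 * D)\<close>; the choice
    \<open>t = 1/2\<close> makes \<open>t - t\<^sup>2\<close> largest and leaves
    \<open>D / 4\<close>.\<close>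
  define z where "z = (\<lambda>y. \<Sum>l<m. (\<delta> l / 2) * sg l y)"
  have abs_\<delta>: "\<bar>\<delta> l\<bar> \<le> 1" for l
  proof -
    have "\<bar>\<Sum>y\<in>\<A>. sg l y\<bar> \<le> (\<Sum>y\<in>\<A>. \<bar>sg l y\<bar>)" by (rule sum_abs)
    also have "\<dots> \<le> (\<Sum>y\<in>\<A>. 1)" by (intro sum_mono) (auto simp: sg_def)
    finally show ?thesis using pos by (simp add: \<delta>_def field_simps)
  qed
  have sum_sg: "(\<Sum>y\<in>\<A>. sg l y) = card \<A> * \<delta> l" for l
    using pos by (simp add: \<delta>_def)
  have "(\<Sum>y\<in>\<A>. z y) = (\<Sum>l<m. \<delta> l / 2 * (\<Sum>y\<in>\<A>. sg l y))"
    unfolding z_def sum_distrib_left by (rule sum.swap)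
  also have "\<dots> = card \<A> * (D / 2)"
    unfolding sum_sg D_def by (simp add: sum_distrib_left sum_divide_distrib power2_eq_square mult_ac)
  finally have mean: "(\<Sum>y\<in>\<A>. z y) = card \<A> * (D / 2)" .
  \<comment> \<open>The tangent of \<open>exp\<close> at the mean \<open>D / 2\<close> of
    \<open>z\<close> lies below the curve, and its linear term sums to zero.\<close>
  have "card \<A> * exp (D / 2) = exp (D / 2) * (\<Sum>y\<in>\<A>. 1 + (z y - D / 2))"
    by (simp add: sum.distrib sum_subtractf mean)
  also have "\<dots> \<le> exp (D / 2) * (\<Sum>y\<in>\<A>. exp (z y - D / 2))"
    by (intro mult_left_mono sum_mono) (auto intro: exp_ge_add_one_self)
  also have "\<dots> = (\<Sum>y\<in>\<A>. exp (z y))"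
    by (simp add: sum_distrib_left flip: exp_add)
  also have "\<dots> \<le> (\<Sum>y\<in>Pow {..<m}. exp (z y))"
    using sub by (intro sum_mono2) auto
  \<comment> \<open>Splitting each summand into factors for members and non-members of
    \<open>y\<close> makes the sum over all subsets the expansion of a product of two-term
    factors.\<close>
  also have "\<dots> = (\<Sum>y\<in>Pow {..<m}. (\<Prod>l\<in>y. exp (\<delta> l / 2)) * (\<Prod>l\<in>{..<m} - y. exp (- \<delta> l / 2)))"
  proof (rule sum.cong[OF refl])
    fix y assume "y \<in> Pow {..<m}"
    then have y: "y \<subseteq> {..<m}" by simp
    have "exp (z y) = (\<Prod>l<m. exp (\<delta> l / 2 * sg l y))"
      by (simp add: z_def exp_sum)
    also have "\<dots> = (\<Prod>l\<in>{..<m} - y. exp (\<delta> l / 2 * sg l y)) * (\<Prod>l\<in>y. exp (\<delta> l / 2 * sg l y))"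
      by (rule prod.subset_diff[OF y]) simp
    finally show "exp (z y) = (\<Prod>l\<in>y. exp (\<delta> l / 2)) * (\<Prod>l\<in>{..<m} - y. exp (- \<delta> l / 2))"
      by (simp add: sg_def mult.commute)
  qed
  also have "\<dots> = (\<Prod>l<m. exp (\<delta> l / 2) + exp (- \<delta> l / 2))"
    by (rule prod_add[symmetric]) simp
  also have "\<dots> = (\<Prod>l<m. 2 * cosh (\<delta> l / 2))"
    by (intro prod.cong refl) (simp add: cosh_field_def field_simps)
  also have "\<dots> \<le> (\<Prod>l<m. 2 * exp ((\<delta> l / 2)\<^sup>2))"
  proof (intro prod_mono conjI mult_left_mono)
    show "cosh (\<delta> l / 2) \<le> exp ((\<delta> l / 2)\<^sup>2)" for l
      using abs_\<delta>[of l] by (intro cosh_le_exp_square) auto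
  qed auto
  also have "\<dots> = 2 ^ m * exp (D / 4)"
    by (simp add: prod.distrib D_def exp_sum power_divide sum_divide_distrib)
  finally have "exp (D / 4) * card \<A> * exp (D / 4) \<le> 2 ^ m * exp (D / 4)"
    by (simp add: mult_ac flip: exp_add)
  then have "exp (D / 4) \<le> 2 ^ m / card \<A>"
    using pos by (simp add: field_simps)
  then have "ln (exp (D / 4)) \<le> ln (2 ^ m / card \<A>)"
    by (subst ln_le_cancel_iff) (use pos in \<open>auto\<close>)
  then show ?thesis by (simp add: D_def)
qed

section \<open>Hellinger distances between half cubes, and an entropy bound\<close>

lemma square_diff_sqrt_le:
  fixes a b :: real
  assumes "0 \<le> a" "0 \<le> b" "0 < a + b"
  shows "(sqrt a - sqrt b)\<^sup>2 \<le> (a - b)\<^sup>2 / (a + b)"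
proof -
  \<comment> \<open>The difference \<open>a - b\<close> factors into \<open>sqrt a - sqrt b\<close>
    and \<open>sqrt a + sqrt b\<close>, and the square of the latter is at least
    \<open>a + b\<close>.\<close>
  have "(sqrt a - sqrt b)\<^sup>2 * (a + b) \<le> (sqrt a - sqrt b)\<^sup>2 * (sqrt a + sqrt b)\<^sup>2"
    using assms by (intro mult_left_mono) (auto simp: power2_sum)
  also have "\<dots> = ((sqrt a)\<^sup>2 - (sqrt b)\<^sup>2)\<^sup>2"
    by (simp add: power2_eq_square algebra_simps)
  finally show ?thesis using assms by (simp add: field_simps)
qed

lemma card_Pow_member:
  assumes "l < m"
  shows "card {y \<in> Pow {..<m}. (l \<in> y) = b} = 2 ^ (m - 1)"
proof -
  have eqF: "{y \<in> Pow {..<m}. (l \<in> y) = False} = Pow ({..<m} - {l})" by auto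
  have "{y \<in> Pow {..<m}. (l \<in> y) = True} = insert l ` Pow ({..<m} - {l})"
  proof (intro set_eqI iffI)
    fix y assume "y \<in> {y \<in> Pow {..<m}. (l \<in> y) = True}"
    then show "y \<in> insert l ` Pow ({..<m} - {l})"
      by (intro image_eqI[of _ _ "y - {l}"]) auto
  qed (use assms in auto)
  moreover have "card (insert l ` Pow ({..<m} - {l})) = card (Pow ({..<m} - {l}))"
    by (intro card_image inj_onI) blast
  ultimately show ?thesis
    using eqF assms by (cases b) (simp_all add: card_Pow)
qed

text \<open>\<open>p l b\<close> is the density of \<open>\<A>\<close> in the half cube where
  coordinate \<open>l\<close> has value \<open>b\<close>. The two densities add up to
  \<open>2 * \<mu>\<close> and differ by \<open>2 * \<mu> * \<delta> l\<close>, where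
  \<open>\<delta> l\<close> is the bias of coordinate \<open>l\<close> on \<open>\<A>\<close>. Each
  term is thus at most \<open>2 * \<mu> * (\<delta> l)\<^sup>2\<close>, and the level-one inequality
  applies.\<close>

lemma sum_hellinger_halves_le:
  fixes \<A> :: "nat set set"
  assumes sub: "\<A> \<subseteq> Pow {..<m}"
  defines "p \<equiv> \<lambda>l b. real (card {y \<in> \<A>. (l \<in> y) = b}) / 2 ^ (m - 1)"
  defines "\<mu> \<equiv> real (card \<A>) / 2 ^ m"
  shows "(\<Sum>l<m. (sqrt (p l True) - sqrt (p l False))\<^sup>2) \<le> 8 * (\<mu> * ln (1 / \<mu>))"
proof (cases "\<A> = {}")
  case True
  then show ?thesis by (simp add: p_def \<mu>_def)
next
  case False
  have fin: "finite \<A>" using sub by (rule finite_subset) auto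
  then have pos: "real (card \<A>) > 0" using False by (simp add: card_gt_0_iff)
  then have \<mu>pos: "\<mu> > 0" by (simp add: \<mu>_def)
  define sg where "sg = (\<lambda>(l::nat) y. if l \<in> y then 1 else (-1 :: real))"
  define \<delta> where "\<delta> = (\<lambda>l. (\<Sum>y\<in>\<A>. sg l y) / card \<A>)"
  have "(sqrt (p l True) - sqrt (p l False))\<^sup>2 \<le> 2 * \<mu> * (\<delta> l)\<^sup>2" if "l < m" for l
  proof -
    have two: "(2::real) ^ m = 2 * 2 ^ (m - 1)"
      using that by (cases m) auto
    have un: "\<A> = {y \<in> \<A>. (l \<in> y) = True} \<union> {y \<in> \<A>. (l \<in> y) = False}" by auto
    have "card \<A> = card {y \<in> \<A>. (l \<in> y) = True} + card {y \<in> \<A>. (l \<in> y) = False}"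
      by (subst un, rule card_Un_disjoint) (use fin in auto)
    then have plus: "p l True + p l False = 2 * \<mu>"
      by (simp add: p_def \<mu>_def two field_simps)
    have "(\<Sum>y\<in>\<A>. sg l y) = real (card {y \<in> \<A>. (l \<in> y) = True}) - card {y \<in> \<A>. (l \<in> y) = False}"
      by (subst un, subst sum.union_disjoint) (use fin in \<open>auto simp: sg_def\<close>)
    then have minus: "p l True - p l False = 2 * \<mu> * \<delta> l"
      using pos by (simp add: p_def \<mu>_def two \<delta>_def field_simps)
    have "(sqrt (p l True) - sqrt (p l False))\<^sup>2 \<le> (p l True - p l False)\<^sup>2 / (p l True + p l False)"
      using plus \<mu>pos by (intro square_diff_sqrt_le) (auto simp: p_def)
    also have "\<dots> = 2 * \<mu> * (\<delta> l)\<^sup>2"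
      using \<mu>pos unfolding plus minus by (simp add: power2_eq_square)
    finally show ?thesis .
  qed
  then have "(\<Sum>l<m. (sqrt (p l True) - sqrt (p l False))\<^sup>2) \<le> (\<Sum>l<m. 2 * \<mu> * (\<delta> l)\<^sup>2)"
    by (intro sum_mono) auto
  also have "\<dots> = 2 * \<mu> * (\<Sum>l<m. (\<delta> l)\<^sup>2)" by (simp add: sum_distrib_left)
  also have "\<dots> \<le> 2 * \<mu> * (4 * ln (2 ^ m / card \<A>))"
    using \<mu>pos level_one_inequality[OF sub False] unfolding \<delta>_def sg_def
    by (intro mult_left_mono) auto
  also have "\<dots> = 8 * (\<mu> * ln (1 / \<mu>))" by (simp add: \<mu>_def)
  finally show ?thesis .
qed

text \<open>One term of Gibbs' inequality, from \<open>ln x \<le> x - 1\<close> at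
  \<open>x = (1/2) ^ d / \<mu>\<close>. It serves to trade the entropy of a transcript for its
  number \<open>d\<close> of bits; the corrections \<open>(1/2) ^ d - \<mu>\<close> cancel once they
  are weighted and summed.\<close>

lemma neg_mult_ln_le:
  fixes \<mu> :: real
  assumes "0 \<le> \<mu>"
  shows "\<mu> * ln (1 / \<mu>) \<le> \<mu> * (real d * ln 2) + (1/2) ^ d - \<mu>"
proof (cases "\<mu> = 0")
  case False
  with assms have \<mu>: "\<mu> > 0" by simp
  have "ln ((1/2) ^ d / \<mu>) \<le> (1/2) ^ d / \<mu> - 1"
    using \<mu> by (intro ln_le_minus_one) simp
  then have "\<mu> * ln ((1/2) ^ d / \<mu>) \<le> (1/2) ^ d - \<mu>"
    using \<mu> by (simp add: field_simps)
  moreover have "ln ((1/2) ^ d / \<mu>) = ln (1 / \<mu>) - real d * ln 2"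
    using \<mu> by (simp add: ln_div ln_realpow)
  ultimately show ?thesis by (simp add: algebra_simps)
qed simp

section \<open>Hellinger distances of product transcripts\<close>

text \<open>Greedy merging: averaged over all pairs of the \<open>M\<close> current blocks, merging a pair changes the
  total by at most the factor \<open>1 + 2 / (M (M - 1)) \<le> exp (2 / (M - 1) - 2 / M)\<close>, and
  these factors telescope.\<close>

lemma merge_blocks:
  fixes f :: "'a set \<Rightarrow> real"
  assumes nonneg: "\<And>A. 0 \<le> f A"
    and spread: "\<And>\<A>. finite \<A> \<Longrightarrow> disjoint \<A> \<Longrightarrow> {} \<notin> \<A> \<Longrightarrow>
      (\<Sum>A\<in>\<A>. \<Sum>B\<in>\<A> - {A}. f (A \<union> B)) \<le> 2 * card \<A> * (\<Sum>A\<in>\<A>. f A)"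
    and "finite \<A>" "disjoint \<A>" "{} \<notin> \<A>" "card \<A> = Suc m"
  shows "f (\<Union>\<A>) \<le> exp (2 - 2 / Suc m) * (\<Sum>A\<in>\<A>. f A)"
  using assms(3-)
proof (induction m arbitrary: \<A>)
  case 0
  then obtain A where "\<A> = {A}" by (auto simp: card_Suc_eq)
  then show ?case by simp
next
  case (Suc m)
  define F where "F = (\<Sum>A\<in>\<A>. f A)"
  define M where "M = real (Suc (Suc m))"
  have M: "M \<ge> 2" "real (card \<A>) = M" "real (Suc m) = M - 1"
    using Suc.prems by (auto simp: M_def)
  \<comment> \<open>The excess for which the total of \<open>f A + f B + g\<close> over ordered
    pairs is exactly the bound \<open>2 * M * F\<close> of \<open>spread\<close>, so some pair stays
    within it.\<close>
  define g where "g = 2 * F / (M * (M - 1))"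
  have "F \<ge> 0" unfolding F_def by (intro sum_nonneg nonneg)
  have card_rest: "real (card (\<A> - {A})) = M - 1" if "A \<in> \<A>" for A
    using that Suc.prems by (simp add: M_def)
  have "\<exists>A\<in>\<A>. \<exists>B\<in>\<A> - {A}. f (A \<union> B) \<le> f A + f B + g"
  proof (rule ccontr)
    assume "\<not> ?thesis"
    then have lt: "f A + f B + g < f (A \<union> B)" if "A \<in> \<A>" "B \<in> \<A> - {A}" for A B
      using that by force
    have ne: "\<A> \<noteq> {}" using Suc.prems by auto
    have ne': "\<A> - {A} \<noteq> {}" for A
    proof
      assume "\<A> - {A} = {}"
      then have "card \<A> \<le> card {A}" by (intro card_mono) auto
      then show False using Suc.prems by simp
    qed
    have "(\<Sum>A\<in>\<A>. \<Sum>B\<in>\<A> - {A}. f A + f B + g) < (\<Sum>A\<in>\<A>. \<Sum>B\<in>\<A> - {A}. f (A \<union> B))"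
      using Suc.prems ne ne' lt by (intro sum_strict_mono) auto
    also have "\<dots> \<le> 2 * M * F"
      using spread[of \<A>] Suc.prems(1-3) by (simp add: F_def flip: M(2))
    also have "2 * M * F = (\<Sum>A\<in>\<A>. \<Sum>B\<in>\<A> - {A}. f A + f B + g)"
    proof -
      have "(\<Sum>B\<in>\<A> - {A}. f A + f B + g) = (M - 1) * f A + (F - f A) + (M - 1) * g" if "A \<in> \<A>" for A
        using that Suc.prems by (simp add: sum.distrib F_def sum_diff1 M_def)
      then have "(\<Sum>A\<in>\<A>. \<Sum>B\<in>\<A> - {A}. f A + f B + g) =
          (\<Sum>A\<in>\<A>. (M - 1) * f A + (F - f A) + (M - 1) * g)" by simp
      also have "\<dots> = (M - 1) * F + (M * F - F) + M * (M - 1) * g"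
        by (simp add: sum.distrib sum_subtractf F_def M flip: sum_distrib_left)
      also have "M * (M - 1) * g = 2 * F" using M by (simp add: g_def)
      finally show ?thesis by (simp add: algebra_simps)
    qed
    finally show False by simp
  qed
  then obtain A B where AB: "A \<in> \<A>" "B \<in> \<A>" "A \<noteq> B" and le: "f (A \<union> B) \<le> f A + f B + g"
    by auto
  define \<B> where "\<B> = \<A> - {A, B}"
  have AB': "A \<inter> B = {}" using AB Suc.prems by (auto simp: disjoint_def)
  have disj: "C \<inter> (A \<union> B) = {}" if "C \<in> \<B>" for C
    using AB Suc.prems that by (auto simp: disjoint_def \<B>_def)
  have "A \<noteq> {}" using AB Suc.prems by auto
  \<comment> \<open>The merged block is nonempty and disjoint from the rest, so merging lowers the
    number of blocks by exactly one.\<close>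
  have notin: "A \<union> B \<notin> \<B>" using disj[of "A \<union> B"] \<open>A \<noteq> {}\<close> by auto
  have \<A>: "\<A> = insert A (insert B \<B>)" using AB by (auto simp: \<B>_def)
  have fin: "finite \<B>" using Suc.prems by (simp add: \<B>_def)
  have "f (\<Union>(insert (A \<union> B) \<B>)) \<le> exp (2 - 2 / Suc m) * (\<Sum>C\<in>insert (A \<union> B) \<B>. f C)"
  proof (rule Suc.IH)
    show "disjoint (insert (A \<union> B) \<B>)"
      using Suc.prems(2) disj by (auto simp: disjoint_def \<B>_def)
    show "card (insert (A \<union> B) \<B>) = Suc m"
      using Suc.prems(4) notin fin AB by (simp add: \<B>_def)
  qed (use Suc.prems fin AB \<open>A \<noteq> {}\<close> in \<open>auto simp: \<B>_def\<close>)
  also have "\<Union>(insert (A \<union> B) \<B>) = \<Union>\<A>" by (auto simp: \<A>)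
  also have "(\<Sum>C\<in>insert (A \<union> B) \<B>. f C) \<le> F + g"
    using notin fin AB le unfolding F_def \<A> by (simp add: \<B>_def)
  also have "F + g = F * (1 + 2 / (M * (M - 1)))" by (simp add: g_def algebra_simps)
  also have "\<dots> \<le> F * exp (2 / (M * (M - 1)))"
    using \<open>F \<ge> 0\<close> by (intro mult_left_mono exp_ge_add_one_self)
  also have "exp (2 - 2 / real (Suc m)) * (F * exp (2 / (M * (M - 1)))) = exp (2 - 2 / M) * F"
  proof -
    have "2 - 2 / N + 2 / ((N + 1) * N) = 2 - 2 / (N + 1)" if "N \<ge> 1" for N :: real
      using that by (simp add: divide_simps) (simp add: algebra_simps)
    from this[of "M - 1"] have "2 - 2 / (M - 1) + 2 / (M * (M - 1)) = 2 - 2 / M"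
      using M(1) by simp
    then show ?thesis unfolding M(3) by (simp add: mult_ac flip: exp_add)
  qed
  finally show ?case by (simp add: F_def M_def)
qed

text \<open>\<open>p i b w\<close> is the factor that player \<open>i\<close> with bit
  \<open>b\<close> contributes to the probability of transcript \<open>w\<close>. It depends on
  \<open>B\<close> only through \<open>i \<in> B\<close>, so factors can be exchanged between
  disjoint sets of players. Merging the singletons \<open>{i}\<close> then costs at most
  \<open>exp 2 \<le> 9\<close>.\<close>

lemma cut_and_paste:
  fixes p :: "nat \<Rightarrow> bool \<Rightarrow> 'l \<Rightarrow> real"
  assumes "k \<ge> 1"
    and nonneg: "\<And>i b w. 0 \<le> p i b w"
    and total: "\<And>B. (\<Sum>w\<in>L. \<Prod>i<k. p i (i \<in> B) w) = 1"
  defines "f \<equiv> \<lambda>B. \<Sum>w\<in>L. (sqrt (\<Prod>i<k. p i (i \<in> B) w) - sqrt (\<Prod>i<k. p i False w))\<^sup>2"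
  shows "f {..<k} \<le> 9 * (\<Sum>i<k. f {i})"
proof -
  define v where "v = (\<lambda>B w. sqrt (\<Prod>i<k. p i (i \<in> B) w))"
  have v_sq: "(v B w)\<^sup>2 = (\<Prod>i<k. p i (i \<in> B) w)" for B w
    unfolding v_def by (intro real_sqrt_pow2 prod_nonneg) (simp add: nonneg)
  have f: "f B = (\<Sum>w\<in>L. (v B w - v {} w)\<^sup>2)" for B
    by (simp add: f_def v_def)
  have dist: "(\<Sum>w\<in>L. (v A w - v B w)\<^sup>2) = f (A \<union> B)" if "A \<inter> B = {}" for A B
  proof -
    \<comment> \<open>the rectangle property of protocols\<close>
    have paste: "v A w * v B w = v (A \<union> B) w * v {} w" for w
    proof -
      have "(\<Prod>i<k. p i (i \<in> A) w) * (\<Prod>i<k. p i (i \<in> B) w) =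
          (\<Prod>i<k. p i (i \<in> A \<union> B) w) * (\<Prod>i<k. p i (i \<in> {}) w)"
        unfolding prod.distrib[symmetric]
      proof (intro prod.cong refl)
        show "p i (i \<in> A) w * p i (i \<in> B) w = p i (i \<in> A \<union> B) w * p i (i \<in> {}) w" for i
          using that by (cases "i \<in> A"; cases "i \<in> B") auto
      qed
      then show ?thesis unfolding v_def real_sqrt_mult[symmetric] by simp
    qed
    \<comment> \<open>By \<open>total\<close> these are unit vectors, so the squared distance is
      determined by the inner product, which pasting preserves.\<close>
    have expand: "(\<Sum>w\<in>L. (v A' w - v B' w)\<^sup>2) = 2 - 2 * (\<Sum>w\<in>L. v A' w * v B' w)" for A' B'
      unfolding power2_diff v_sq
      by (simp add: sum.distrib sum_subtractf total mult.assoc flip: sum_distrib_left)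
    show ?thesis unfolding f expand paste ..
  qed
  have spread: "(\<Sum>A\<in>\<A>. \<Sum>B\<in>\<A> - {A}. f (A \<union> B)) \<le> 2 * card \<A> * (\<Sum>A\<in>\<A>. f A)"
    if \<A>: "finite \<A>" "disjoint \<A>" for \<A>
  proof -
    have "(\<Sum>A\<in>\<A>. \<Sum>B\<in>\<A> - {A}. f (A \<union> B)) = (\<Sum>A\<in>\<A>. \<Sum>B\<in>\<A> - {A}. \<Sum>w\<in>L. (v A w - v B w)\<^sup>2)"
      using \<A>(2) by (intro sum.cong refl dist[symmetric]) (auto simp: disjoint_def)
    \<comment> \<open>The added diagonal terms are zero.\<close>
    also have "\<dots> = (\<Sum>A\<in>\<A>. \<Sum>B\<in>\<A>. \<Sum>w\<in>L. (v A w - v B w)\<^sup>2)"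
      using \<A>(1) by (intro sum.cong refl sum.mono_neutral_left) auto
    also have "\<dots> = (\<Sum>A\<in>\<A>. \<Sum>w\<in>L. \<Sum>B\<in>\<A>. (v A w - v B w)\<^sup>2)"
      by (intro sum.cong refl sum.swap)
    also have "\<dots> = (\<Sum>w\<in>L. \<Sum>A\<in>\<A>. \<Sum>B\<in>\<A>. (v A w - v B w)\<^sup>2)"
      by (rule sum.swap)
    also have "\<dots> \<le> (\<Sum>w\<in>L. 2 * card \<A> * (\<Sum>A\<in>\<A>. (v A w - v {} w)\<^sup>2))"
    proof (intro sum_mono)
      fix w
      define u where "u = (\<lambda>A. v A w - v {} w)"
      have "(\<Sum>A\<in>\<A>. \<Sum>B\<in>\<A>. (v A w - v B w)\<^sup>2) =
          (\<Sum>A\<in>\<A>. \<Sum>B\<in>\<A>. (u A)\<^sup>2 + (u B)\<^sup>2 - 2 * (u A * u B))"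
        by (intro sum.cong refl) (simp add: u_def power2_eq_square algebra_simps)
      \<comment> \<open>Measured from \<open>v {}\<close>, the cross terms add up to a square, which
        is then dropped.\<close>
      also have "\<dots> = 2 * card \<A> * (\<Sum>A\<in>\<A>. (u A)\<^sup>2) - 2 * (\<Sum>A\<in>\<A>. u A)\<^sup>2"
        by (simp add: sum.distrib sum_subtractf sum_product power2_eq_square
            flip: sum_distrib_left)
      also have "\<dots> \<le> 2 * card \<A> * (\<Sum>A\<in>\<A>. (u A)\<^sup>2)" by simp
      finally show "(\<Sum>A\<in>\<A>. \<Sum>B\<in>\<A>. (v A w - v B w)\<^sup>2) \<le>
          2 * card \<A> * (\<Sum>A\<in>\<A>. (v A w - v {} w)\<^sup>2)" by (simp add: u_def)
    qed
    also have "\<dots> = 2 * card \<A> * (\<Sum>A\<in>\<A>. f A)"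
      unfolding f sum_distrib_left by (rule sum.swap)
    finally show ?thesis .
  qed
  define \<A> where "\<A> = (\<lambda>i::nat. {i}) ` {..<k}"
  have "card \<A> = k" unfolding \<A>_def by (subst card_image) auto
  have "f (\<Union>\<A>) \<le> exp (2 - 2 / Suc (k - 1)) * (\<Sum>A\<in>\<A>. f A)"
  proof (rule merge_blocks)
    show "0 \<le> f A" for A unfolding f by (intro sum_nonneg) auto
    show "card \<A> = Suc (k - 1)" using \<open>card \<A> = k\<close> \<open>k \<ge> 1\<close> by simp
    show "disjoint \<A>" by (auto simp: \<A>_def disjoint_def)
  qed (use spread in \<open>auto simp: \<A>_def\<close>)
  also have "(\<Sum>A\<in>\<A>. f A) = (\<Sum>i<k. f {i})"
    unfolding \<A>_def by (subst sum.reindex) auto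
  also have "\<Union>\<A> = {..<k}" by (auto simp: \<A>_def)
  also have "exp (2 - 2 / Suc (k - 1)) * (\<Sum>i<k. f {i}) \<le> 9 * (\<Sum>i<k. f {i})"
  proof (rule mult_right_mono)
    have "exp (2 - 2 / Suc (k - 1)) \<le> exp (2::real)" by simp
    also have "\<dots> = exp 1 * exp (1::real)" by (simp flip: exp_add)
    also have "\<dots> \<le> 3 * 3" by (intro mult_mono exp_le) auto
    finally show "exp (2 - 2 / Suc (k - 1)) \<le> (9::real)" by simp
    show "0 \<le> (\<Sum>i<k. f {i})" unfolding f by (intro sum_nonneg) auto
  qed
  finally show ?thesis .
qed

section \<open>Transcripts and rectangles\<close>

fun paths :: "proto \<Rightarrow> bool list set" where
  "paths (Leaf b) = {[]}"
| "paths (Node i f t0 t1) = (#) False ` paths t0 \<union> (#) True ` paths t1"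

fun transcript :: "proto \<Rightarrow> (nat \<Rightarrow> nat set) \<Rightarrow> bool list" where
  "transcript (Leaf b) X = []"
| "transcript (Node i f t0 t1) X =
     (if f (X i) then True # transcript t1 X else False # transcript t0 X)"

text \<open>The condition that \<open>w\<close> puts on a single player: \<open>w\<close> is a path,
  and \<open>i\<close> holding \<open>x\<close> would write the bits recorded at its own nodes.
  Imposed on all players it describes the inputs with transcript \<open>w\<close>, which therefore
  form a rectangle.\<close>

fun agrees :: "proto \<Rightarrow> bool list \<Rightarrow> nat \<Rightarrow> nat set \<Rightarrow> bool" where
  "agrees (Leaf b) w i x \<longleftrightarrow> w = []"
| "agrees (Node j f t0 t1) [] i x \<longleftrightarrow> False"
| "agrees (Node j f t0 t1) (b # w) i x \<longleftrightarrow>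
     (j = i \<longrightarrow> f x = b) \<and> (if b then agrees t1 w i x else agrees t0 w i x)"

text \<open>\<open>verdict\<close> and \<open>spoken\<close> make output and cost functions of the
  written bits alone. Strings that stop at an inner node get default values.\<close>

fun verdict :: "proto \<Rightarrow> bool list \<Rightarrow> bool" where
  "verdict (Leaf b) w = b"
| "verdict (Node j f t0 t1) [] = False"
| "verdict (Node j f t0 t1) (b # w) = (if b then verdict t1 w else verdict t0 w)"

fun spoken :: "proto \<Rightarrow> bool list \<Rightarrow> nat \<Rightarrow> nat" where
  "spoken (Leaf b) w i = 0"
| "spoken (Node j f t0 t1) [] i = 0"
| "spoken (Node j f t0 t1) (b # w) i =
     (if j = i then 1 else 0) + (if b then spoken t1 w i else spoken t0 w i)"

lemma finite_paths [simp, intro]: "finite (paths P)"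
  by (induction P) auto

lemma transcript_in_paths: "transcript P X \<in> paths P"
  by (induction P) auto

lemma transcript_eq_iff: "transcript P X = w \<longleftrightarrow> (\<forall>i. agrees P w i (X i))"
proof (induction P arbitrary: w)
  case (Node j f t0 t1)
  then show ?case by (cases w; cases "hd w"; cases "f (X j)") auto
qed auto

lemma verdict_transcript: "verdict P (transcript P X) = run P X"
  by (induction P) auto

lemma spoken_transcript: "spoken P (transcript P X) i = bits P X i"
  by (induction P) auto

text \<open>With the inputs of the others fixed, only the nodes of player \<open>i\<close> branch.
  Mass 1 at the root, halved at each such node, arrives as \<open>(1/2) ^ spoken P w i\<close> at
  the leaf of \<open>w\<close>, and nothing is lost on the way.\<close>

lemma kraft:
  "(\<Sum>w | w \<in> paths P \<and> (\<forall>j. j \<noteq> i \<longrightarrow> agrees P w j (X j)). (1/2 :: real) ^ spoken P w i) = 1"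
proof (induction P)
  case (Leaf b)
  have "{w. w \<in> paths (Leaf b) \<and> (\<forall>j. j \<noteq> i \<longrightarrow> agrees (Leaf b) w j (X j))} = {[]}" by auto
  then show ?case by simp
next
  case (Node j f t0 t1)
  define S where "S = (\<lambda>t. {w. w \<in> paths t \<and> (\<forall>j. j \<noteq> i \<longrightarrow> agrees t w j (X j))})"
  have S: "{w. w \<in> paths t \<and> (\<forall>j. j \<noteq> i \<longrightarrow> agrees t w j (X j))} = S t" for t
    by (simp add: S_def)
  have fin: "finite (S t)" for t by (simp add: S_def)
  have shift: "(\<Sum>w\<in>(#) b ` S t. g w) = (\<Sum>w\<in>S t. g (b # w))" for b t and g :: "bool list \<Rightarrow> real"
    by (subst sum.reindex) auto
  show ?case
  proof (cases "j = i")
    case True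
    have "S (Node j f t0 t1) = (#) False ` S t0 \<union> (#) True ` S t1"
      by (auto simp: S_def True)
    moreover have "(\<Sum>w\<in>(#) False ` S t0 \<union> (#) True ` S t1. (1/2 :: real) ^ spoken (Node j f t0 t1) w i) =
      (\<Sum>w\<in>S t0. (1/2) * (1/2) ^ spoken t0 w i) + (\<Sum>w\<in>S t1. (1/2) * (1/2) ^ spoken t1 w i)"
      by (subst sum.union_disjoint) (auto simp: fin shift True)
    ultimately show ?thesis using Node.IH
      unfolding S sum_distrib_left[symmetric] by simp
  next
    case False
    define t where "t = (if f (X j) then t1 else t0)"
    have "S (Node j f t0 t1) = (#) (f (X j)) ` S t"
      using False by (auto simp: S_def t_def)
    then show ?thesis using Node.IH False
      unfolding S by (simp add: shift t_def)
  qed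
qed

section \<open>Transcript probabilities for independent players\<close>

definition prob_agrees :: "proto \<Rightarrow> ('a \<Rightarrow> nat set) \<Rightarrow> 'a set \<Rightarrow> nat \<Rightarrow> bool list \<Rightarrow> real" where
  "prob_agrees P \<phi> A i w = real (card {y \<in> A. agrees P w i (\<phi> y)}) / real (card A)"

lemma prob_agrees_nonneg [simp]: "0 \<le> prob_agrees P \<phi> A i w"
  by (simp add: prob_agrees_def)

text \<open>Independent uniform choices \<open>Y i\<close> from \<open>A i\<close> all follow
  \<open>w\<close> with the product of the individual probabilities; the rest exchanges the sums
  over \<open>w\<close> and \<open>Y\<close>.\<close>

lemma sum_prod_prob_agrees:
  assumes fin: "finite I" "finite L" "\<And>i. i \<in> I \<Longrightarrow> finite (A i)"
  shows "(\<Sum>w\<in>L. g w * (\<Prod>i\<in>I. prob_agrees P (\<phi> i) (A i) i w)) =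
    (\<Sum>Y\<in>PiE I A. \<Sum>w | w \<in> L \<and> (\<forall>i\<in>I. agrees P w i (\<phi> i (Y i))). g w) / real (card (PiE I A))"
proof -
  have "(\<Sum>w\<in>L. g w * (\<Prod>i\<in>I. prob_agrees P (\<phi> i) (A i) i w)) =
    (\<Sum>w\<in>L. \<Sum>Y | Y \<in> PiE I A \<and> (\<forall>i\<in>I. agrees P w i (\<phi> i (Y i))). g w) / real (card (PiE I A))"
    unfolding sum_divide_distrib
  proof (intro sum.cong refl)
    fix w
    have "{Y. Y \<in> PiE I A \<and> (\<forall>i\<in>I. agrees P w i (\<phi> i (Y i)))} =
        PiE I (\<lambda>i. {y \<in> A i. agrees P w i (\<phi> i y)})"
      by (auto simp: PiE_iff extensional_def)
    then show "g w * (\<Prod>i\<in>I. prob_agrees P (\<phi> i) (A i) i w) =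
      (\<Sum>Y | Y \<in> PiE I A \<and> (\<forall>i\<in>I. agrees P w i (\<phi> i (Y i))). g w / real (card (PiE I A)))"
      using fin(1) by (simp add: prob_agrees_def prod_dividef card_PiE)
  qed
  also have "(\<Sum>w\<in>L. \<Sum>Y | Y \<in> PiE I A \<and> (\<forall>i\<in>I. agrees P w i (\<phi> i (Y i))). g w) =
    (\<Sum>Y\<in>PiE I A. \<Sum>w | w \<in> L \<and> (\<forall>i\<in>I. agrees P w i (\<phi> i (Y i))). g w)"
    using fin by (intro sum.swap_restrict) (auto intro: finite_PiE)
  finally show ?thesis .
qed

text \<open>A node may name a speaker \<open>i \<ge> k\<close>. Such a player always holds
  \<open>{}\<close>, so its bits are forced; only the paths that respect them can occur.\<close>

definition live :: "nat \<Rightarrow> proto \<Rightarrow> bool list set" where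
  "live k P = {w \<in> paths P. \<forall>i\<ge>k. agrees P w i {}}"

lemma finite_live [simp, intro]: "finite (live k P)"
  by (simp add: live_def)

definition input_of :: "nat \<Rightarrow> (nat \<Rightarrow> 'a \<Rightarrow> nat set) \<Rightarrow> (nat \<Rightarrow> 'a) \<Rightarrow> nat \<Rightarrow> nat set" where
  "input_of k \<phi> Y = (\<lambda>i. if i < k then \<phi> i (Y i) else {})"

text \<open>Each choice \<open>Y\<close> follows exactly one live path, its own transcript, so the
  weighted sum is an expectation of \<open>g\<close> at the transcript.\<close>

lemma sum_live_prod_prob_agrees:
  assumes "\<And>i. i < k \<Longrightarrow> finite (A i)"
  shows "(\<Sum>w\<in>live k P. g w * (\<Prod>i<k. prob_agrees P (\<phi> i) (A i) i w)) =
    (\<Sum>Y\<in>PiE {..<k} A. g (transcript P (input_of k \<phi> Y))) / real (card (PiE {..<k} A))"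
proof -
  have "{w. w \<in> live k P \<and> (\<forall>i\<in>{..<k}. agrees P w i (\<phi> i (Y i)))} = {transcript P (input_of k \<phi> Y)}"
    (is "?S = {?w}") for Y
  proof -
    have "w \<in> ?S \<longleftrightarrow> w \<in> paths P \<and> (\<forall>i. agrees P w i (input_of k \<phi> Y i))" for w
      by (auto simp: live_def input_of_def not_less)
    also have "\<dots> w \<longleftrightarrow> w = ?w" for w
      unfolding transcript_eq_iff[symmetric] using transcript_in_paths by auto
    finally show ?thesis by blast
  qed
  then show ?thesis using assms by (subst sum_prod_prob_agrees) auto
qed

lemma sum_live_prod_prob_agrees_le:
  assumes "\<And>i. i < k \<Longrightarrow> finite (A i)" "\<And>i. i < k \<Longrightarrow> A i \<noteq> {}"
    and "\<And>Y. Y \<in> PiE {..<k} A \<Longrightarrow> g (transcript P (input_of k \<phi> Y)) \<le> c"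
  shows "(\<Sum>w\<in>live k P. g w * (\<Prod>i<k. prob_agrees P (\<phi> i) (A i) i w)) \<le> c"
proof -
  have "finite (PiE {..<k} A)" "PiE {..<k} A \<noteq> {}"
    using assms by (auto intro: finite_PiE simp: PiE_eq_empty_iff)
  then have pos: "real (card (PiE {..<k} A)) > 0" by (simp add: card_gt_0_iff)
  have "(\<Sum>Y\<in>PiE {..<k} A. g (transcript P (input_of k \<phi> Y))) \<le> (\<Sum>Y\<in>PiE {..<k} A. c)"
    using assms(3) by (rule sum_mono)
  then show ?thesis
    using pos assms(1) by (subst sum_live_prod_prob_agrees) (auto simp: field_simps)
qed

lemma sum_live_prod_prob_agrees_one:
  assumes "\<And>i. i < k \<Longrightarrow> finite (A i)" "\<And>i. i < k \<Longrightarrow> A i \<noteq> {}"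
  shows "(\<Sum>w\<in>live k P. \<Prod>i<k. prob_agrees P (\<phi> i) (A i) i w) = 1"
proof -
  have "finite (PiE {..<k} A)" "PiE {..<k} A \<noteq> {}"
    using assms by (auto intro: finite_PiE simp: PiE_eq_empty_iff)
  then have "card (PiE {..<k} A) \<noteq> 0" by simp
  then show ?thesis
    using sum_live_prod_prob_agrees[of k A "\<lambda>_. 1" P \<phi>] assms(1) by simp
qed

text \<open>Kraft's equality holds for every fixed choice of the players other than
  \<open>i\<close>, hence also on average over these choices.\<close>

lemma sum_live_kraft:
  assumes "i < k" "\<And>j. j < k \<Longrightarrow> j \<noteq> i \<Longrightarrow> finite (A j)" "\<And>j. j < k \<Longrightarrow> j \<noteq> i \<Longrightarrow> A j \<noteq> {}"
  shows "(\<Sum>w\<in>live k P. (1/2) ^ spoken P w i *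
    (\<Prod>j\<in>{..<k} - {i}. prob_agrees P (\<phi> j) (A j) j w)) = 1"
proof -
  let ?I = "{..<k} - {i}"
  have "finite (PiE ?I A)" "PiE ?I A \<noteq> {}"
    using assms by (auto intro: finite_PiE simp: PiE_eq_empty_iff)
  then have "card (PiE ?I A) \<noteq> 0" by simp
  moreover have "{w. w \<in> live k P \<and> (\<forall>j\<in>?I. agrees P w j (\<phi> j (Y j)))} =
     {w. w \<in> paths P \<and> (\<forall>j. j \<noteq> i \<longrightarrow> agrees P w j (input_of k \<phi> Y j))}" for Y
    using assms(1) by (auto simp: live_def input_of_def not_less)
  ultimately show ?thesis
    using assms by (subst sum_prod_prob_agrees) (auto simp: kraft)
qed

text \<open>The probability of \<open>w\<close> splits as \<open>q w * \<mu> w\<close> into the part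
  of the other players and that of player \<open>i\<close>. The bound on half cubes turns the sum
  over \<open>l\<close> into \<open>8 * (\<mu> w * ln (1 / \<mu> w))\<close>, and Gibbs' inequality
  with \<open>d = spoken P w i\<close> turns this into an expected number of bits.\<close>

lemma sum_hellinger_le_communication:
  fixes \<phi> :: "nat \<Rightarrow> nat set \<Rightarrow> nat set"
  assumes i: "i < k" and A: "\<And>j. j < k \<Longrightarrow> finite (A j)" "\<And>j. j < k \<Longrightarrow> A j \<noteq> {}"
    and Ai: "A i = Pow {..<m}"
    and le: "\<And>Y. Y \<in> PiE {..<k} A \<Longrightarrow> bits P (input_of k \<phi> Y) i \<le> C"
  defines "p \<equiv> \<lambda>l b. prob_agrees P (\<phi> i) {y \<in> Pow {..<m}. (l \<in> y) = b} i"
  shows "(\<Sum>l<m. \<Sum>w\<in>live k P. (\<Prod>j\<in>{..<k} - {i}. prob_agrees P (\<phi> j) (A j) j w) *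
      (sqrt (p l True w) - sqrt (p l False w))\<^sup>2) \<le> 8 * real C"
proof -
  define q where "q = (\<lambda>w. \<Prod>j\<in>{..<k} - {i}. prob_agrees P (\<phi> j) (A j) j w)"
  define \<mu> where "\<mu> = prob_agrees P (\<phi> i) (A i) i"
  have q_nonneg: "0 \<le> q w" for w unfolding q_def by (intro prod_nonneg) simp
  have q\<mu>: "q w * \<mu> w = (\<Prod>j<k. prob_agrees P (\<phi> j) (A j) j w)" for w
    unfolding q_def \<mu>_def using i by (subst (2) prod.remove[of _ i]) (auto simp: mult.commute)
  have "(\<Sum>l<m. \<Sum>w\<in>live k P. q w * (sqrt (p l True w) - sqrt (p l False w))\<^sup>2) =
    (\<Sum>w\<in>live k P. q w * (\<Sum>l<m. (sqrt (p l True w) - sqrt (p l False w))\<^sup>2))"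
    unfolding sum_distrib_left by (rule sum.swap)
  also have "\<dots> \<le> (\<Sum>w\<in>live k P. q w * (8 * (\<mu> w * ln (1 / \<mu> w))))"
  proof (intro sum_mono mult_left_mono q_nonneg)
    fix w
    let ?\<A> = "{y \<in> Pow {..<m}. agrees P w i (\<phi> i y)}"
    have "(\<Sum>l<m. (sqrt (p l True w) - sqrt (p l False w))\<^sup>2) =
      (\<Sum>l<m. (sqrt (real (card {y \<in> ?\<A>. (l \<in> y) = True}) / 2 ^ (m - 1)) -
        sqrt (real (card {y \<in> ?\<A>. (l \<in> y) = False}) / 2 ^ (m - 1)))\<^sup>2)"
    proof (intro sum.cong refl)
      fix l assume "l \<in> {..<m}"
      then have "p l b w = real (card {y \<in> ?\<A>. (l \<in> y) = b}) / 2 ^ (m - 1)" for b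
        using card_Pow_member[of l m b] unfolding p_def prob_agrees_def
        by (simp add: conj_ac)
      then show "(sqrt (p l True w) - sqrt (p l False w))\<^sup>2 =
        (sqrt (real (card {y \<in> ?\<A>. (l \<in> y) = True}) / 2 ^ (m - 1)) -
         sqrt (real (card {y \<in> ?\<A>. (l \<in> y) = False}) / 2 ^ (m - 1)))\<^sup>2" by simp
    qed
    also have "\<dots> \<le> 8 * (real (card ?\<A>) / 2 ^ m * ln (1 / (real (card ?\<A>) / 2 ^ m)))"
      by (rule sum_hellinger_halves_le) auto
    also have "real (card ?\<A>) / 2 ^ m = \<mu> w"
      by (simp add: \<mu>_def prob_agrees_def Ai card_Pow)
    finally show "(\<Sum>l<m. (sqrt (p l True w) - sqrt (p l False w))\<^sup>2) \<le> 8 * (\<mu> w * ln (1 / \<mu> w))" .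
  qed
  also have "\<dots> \<le> (\<Sum>w\<in>live k P. q w * (8 * (\<mu> w * (real (spoken P w i) * ln 2) +
      (1/2) ^ spoken P w i - \<mu> w)))"
    by (intro sum_mono mult_left_mono q_nonneg neg_mult_ln_le) (auto simp: \<mu>_def)
  also have "\<dots> = 8 * (ln 2 * (\<Sum>w\<in>live k P. real (spoken P w i) * (q w * \<mu> w)) +
      (\<Sum>w\<in>live k P. (1/2) ^ spoken P w i * q w) - (\<Sum>w\<in>live k P. q w * \<mu> w))"
    by (simp add: sum_distrib_left sum.distrib sum_subtractf algebra_simps)
  also have "(\<Sum>w\<in>live k P. q w * \<mu> w) = 1"
    unfolding q\<mu> using A by (rule sum_live_prod_prob_agrees_one)
  \<comment> \<open>By Kraft this mass equals the total probability, so the two corrections cancel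
    and \<open>ln 2\<close> times the expected number of bits remains.\<close>
  also have "(\<Sum>w\<in>live k P. (1/2) ^ spoken P w i * q w) = 1"
    unfolding q_def using i A by (intro sum_live_kraft) auto
  also have "8 * (ln 2 * (\<Sum>w\<in>live k P. real (spoken P w i) * (q w * \<mu> w)) + 1 - 1) \<le> 8 * (1 * real C)"
  proof -
    have "(\<Sum>w\<in>live k P. real (spoken P w i) * (q w * \<mu> w)) \<le> real C"
      unfolding q\<mu> using A
      by (rule sum_live_prod_prob_agrees_le) (use le in \<open>simp_all add: spoken_transcript\<close>)
    moreover have "0 \<le> (\<Sum>w\<in>live k P. real (spoken P w i) * (q w * \<mu> w))"
      using q_nonneg by (intro sum_nonneg mult_nonneg_nonneg) (auto simp: \<mu>_def)
    moreover have "ln (2::real) \<le> 1" using ln_le_minus_one[of "2::real"] by simp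
    ultimately have "ln 2 * (\<Sum>w\<in>live k P. real (spoken P w i) * (q w * \<mu> w)) \<le> 1 * real C"
      by (intro mult_mono) auto
    then show ?thesis by simp
  qed
  finally show ?thesis by (simp add: q_def)
qed

section \<open>Symmetry of the input distributions\<close>

definition relabel :: "(nat \<Rightarrow> nat) \<Rightarrow> (nat \<Rightarrow> nat set) \<Rightarrow> nat \<Rightarrow> nat set" where
  "relabel \<sigma> X = (\<lambda>i. \<sigma> ` X i)"

lemma finite_inputs [simp, intro]: "finite (inputs k n)"
proof (rule finite_subset)
  show "inputs k n \<subseteq> PiE_dflt {..<k} {} (\<lambda>_. Pow {0..<n})"
    by (auto simp: inputs_def PiE_dflt_def)
qed auto

lemma Fs_subset_inputs: "Fs b k n s \<subseteq> inputs k n"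
  by (auto simp: Fs_def F0_def F1_def)

lemma finite_Fs [simp, intro]: "finite (Fs b k n s)"
  by (rule finite_subset[OF Fs_subset_inputs]) auto

lemma relabel_inputs:
  assumes "\<sigma> permutes {0..<n}" "X \<in> inputs k n"
  shows "relabel \<sigma> X \<in> inputs k n"
  using assms permutes_in_image[OF assms(1)] by (fastforce simp: inputs_def relabel_def)

lemma col_relabel:
  assumes "\<sigma> permutes S"
  shows "col k (relabel \<sigma> X) (\<sigma> j) = col k X j"
  using permutes_inj[OF assms] by (simp add: col_def relabel_def inj_image_mem_iff)

lemma relabel_Fs:
  assumes \<sigma>: "\<sigma> permutes {0..<n}" and X: "X \<in> Fs b k n s"
  shows "relabel \<sigma> X \<in> Fs b k n s"
proof -
  have X': "X \<in> inputs k n" using X Fs_subset_inputs by blast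
  have in_range: "\<sigma> j < n \<longleftrightarrow> j < n" for j using permutes_in_image[OF \<sigma>, of j] by simp
  \<comment> \<open>Quantifiers over coordinates can be pulled back along \<sigma>, so the defining
    conditions transfer column by column.\<close>
  have all: "(\<forall>j<n. Q j) \<longleftrightarrow> (\<forall>j<n. Q (\<sigma> j))" for Q
  proof
    assume *: "\<forall>j<n. Q (\<sigma> j)"
    show "\<forall>j<n. Q j"
    proof (intro allI impI)
      fix j assume "j < n"
      obtain i where "j = \<sigma> i" using permutes_surj[OF \<sigma>] by (meson surjD)
      then show "Q j" using * in_range \<open>j < n\<close> by auto
    qed
  qed (use in_range in auto)
  have ex: "(\<exists>j<n. Q j) \<longleftrightarrow> (\<exists>j<n. Q (\<sigma> j))" for Q
    using all[of "\<lambda>j. \<not> Q j"] by blast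
  have "card (relabel \<sigma> X i) = card (X i)" for i
    unfolding relabel_def by (intro card_image permutes_inj_on[OF \<sigma>])
  moreover have "relabel \<sigma> X \<in> (if b then F1 k n else F0 k n)"
  proof (cases b)
    case True
    have "(\<exists>j<n. col k (relabel \<sigma> X) j = k \<and>
        (\<forall>j'<n. j' \<noteq> j \<longrightarrow> col k (relabel \<sigma> X) j' \<le> 1)) \<longleftrightarrow>
        (\<exists>j<n. col k X j = k \<and> (\<forall>j'<n. j' \<noteq> j \<longrightarrow> col k X j' \<le> 1))"
      unfolding ex[of "\<lambda>j. col k (relabel \<sigma> X) j = k \<and>
        (\<forall>j'<n. j' \<noteq> j \<longrightarrow> col k (relabel \<sigma> X) j' \<le> 1)"]
        all[of "\<lambda>j'. j' \<noteq> \<sigma> j \<longrightarrow> col k (relabel \<sigma> X) j' \<le> 1" for j]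
      by (simp only: col_relabel[OF \<sigma>] inj_eq[OF permutes_inj[OF \<sigma>]])
    then show ?thesis using True X relabel_inputs[OF \<sigma> X'] by (simp add: Fs_def F1_def)
  next
    case False
    have "(\<forall>j<n. col k (relabel \<sigma> X) j \<le> 1) \<longleftrightarrow> (\<forall>j<n. col k X j \<le> 1)"
      unfolding all[of "\<lambda>j. col k (relabel \<sigma> X) j \<le> 1"] by (simp only: col_relabel[OF \<sigma>])
    then show ?thesis using False X relabel_inputs[OF \<sigma> X'] by (simp add: Fs_def F0_def)
  qed
  ultimately show ?thesis using X by (simp add: Fs_def)
qed

section \<open>Column types and the orbits of relabelling\<close>

definition owners :: "nat \<Rightarrow> (nat \<Rightarrow> nat set) \<Rightarrow> nat \<Rightarrow> nat set" where
  "owners k X j = {i \<in> {0..<k}. j \<in> X i}"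

lemma col_eq_card_owners: "col k X j = card (owners k X j)"
  by (simp add: col_def owners_def)

lemma finite_owners [simp]: "finite (owners k X j)"
  by (simp add: owners_def)

lemma owners_eq_singleton:
  assumes "i \<in> owners k X j" "col k X j \<le> 1"
  shows "owners k X j = {i}"
proof -
  have "card (owners k X j) \<le> card {i}" using assms by (simp add: col_eq_card_owners)
  then show ?thesis using assms(1) card_seteq[of "owners k X j" "{i}"] by simp
qed

text \<open>The point is that the count does not depend on \<open>X\<close>. Outside the common
  column every nonempty column belongs to a single player, and for true \<open>b\<close> the common
  column takes one point from each \<open>X i\<close>. As \<open>k \<ge> 2\<close>, the full set is
  not a singleton and the cases do not overlap.\<close>

lemma card_owners_eq:
  assumes X: "X \<in> Fs b k n s" and k: "k \<ge> 2" and T: "T \<noteq> {}"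
  shows "card {j \<in> {0..<n}. owners k X j = T} =
    (if \<exists>i<k. T = {i} then s (THE i. T = {i}) - of_bool b else if T = {0..<k} then of_bool b else 0)"
proof -
  have inp: "X i \<subseteq> {0..<n}" if "i < k" for i
    using X Fs_subset_inputs that by (force simp: inputs_def)
  have card_X: "card (X i) = s i" if "i < k" for i using X that by (simp add: Fs_def)
  have fin: "finite (X i)" if "i < k" for i using inp[OF that] by (rule finite_subset) auto
  have mem: "i \<in> owners k X j \<longleftrightarrow> j \<in> X i" if "i < k" for i j
    using that by (simp add: owners_def)
  have range: "{0..<k} \<noteq> {i}" for i
  proof
    assume "{0..<k} = {i}"
    then have "card {0..<k} = 1" by simp
    then show False using k by simp
  qed
  show ?thesis
  proof (cases b)
    case False
    then have col: "col k X j \<le> 1" if "j < n" for j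
      using X that by (simp add: Fs_def F0_def)
    show ?thesis
    proof (cases "\<exists>i<k. T = {i}")
      case True
      then obtain i where i: "i < k" "T = {i}" by auto
      have "{j \<in> {0..<n}. owners k X j = {i}} = X i"
      proof (intro set_eqI iffI)
        fix j assume j: "j \<in> X i"
        then have "j < n" using inp[OF i(1)] by auto
        then show "j \<in> {j \<in> {0..<n}. owners k X j = {i}}"
          using owners_eq_singleton[OF _ col] mem[OF i(1)] j by auto
      qed (use mem[OF i(1)] in auto)
      then show ?thesis using i False card_X by simp
    next
      case nT: False
      have "owners k X j \<noteq> T" if "j < n" for j
      proof
        assume eq: "owners k X j = T"
        then obtain i where "i \<in> owners k X j" using T by auto
        then show False using owners_eq_singleton[OF _ col[OF that]] eq nT
          by (auto simp: owners_def)
      qed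
      then have none: "{j \<in> {0..<n}. owners k X j = T} = {}" by auto
      show ?thesis unfolding if_not_P[OF nT] none using False by simp
    qed
  next
    case True
    then obtain c where c: "c < n" "col k X c = k"
      and col: "\<And>j. j < n \<Longrightarrow> j \<noteq> c \<Longrightarrow> col k X j \<le> 1"
      using X by (auto simp: Fs_def F1_def)
    have oc: "owners k X c = {0..<k}"
      using c by (intro card_seteq) (auto simp: owners_def col_def)
    show ?thesis
    proof (cases "\<exists>i<k. T = {i}")
      case True
      then obtain i where i: "i < k" "T = {i}" by auto
      have "c \<in> X i" using mem[OF i(1), of c] i(1) unfolding oc by simp
      have "{j \<in> {0..<n}. owners k X j = {i}} = X i - {c}"
      proof (intro set_eqI iffI)
        fix j assume j: "j \<in> X i - {c}"
        then have "j < n" "j \<noteq> c" using inp[OF i(1)] by auto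
        then show "j \<in> {j \<in> {0..<n}. owners k X j = {i}}"
          using owners_eq_singleton[OF _ col] mem[OF i(1)] j by auto
      next
        fix j assume "j \<in> {j \<in> {0..<n}. owners k X j = {i}}"
        then show "j \<in> X i - {c}" using mem[OF i(1)] oc range[of i] by auto
      qed
      then show ?thesis using i \<open>b\<close> card_X fin \<open>c \<in> X i\<close> by simp
    next
      case nT: False
      have *: "owners k X j \<noteq> T" if "j < n" "j \<noteq> c" for j
      proof
        assume eq: "owners k X j = T"
        then obtain i where "i \<in> owners k X j" using T by auto
        then show False using owners_eq_singleton[OF _ col[OF that]] eq nT
          by (auto simp: owners_def)
      qed
      have full: "{j \<in> {0..<n}. owners k X j = T} = (if T = {0..<k} then {c} else {})"
        using * oc c by auto
      show ?thesis unfolding if_not_P[OF nT] full using \<open>b\<close> by simp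
    qed
  qed
qed

text \<open>Equal multisets of columns are matched by a permutation of the coordinates, and the
  counts of nonempty columns agree by \<open>card_owners_eq\<close>.\<close>

lemma Fs_transitive:
  assumes X: "X \<in> Fs b k n s" "X' \<in> Fs b k n s" and k: "k \<ge> 2"
  obtains \<rho> where "\<rho> permutes {0..<n}" "X' = relabel \<rho> X"
proof -
  define M where "M = (\<lambda>X. image_mset (owners k X) (mset_set {0..<n}))"
  have count_M: "count (M Z) T = card {j \<in> {0..<n}. owners k Z j = T}" for Z T
  proof -
    have "count (M Z) T = (\<Sum>j | j \<in> {0..<n} \<and> T = owners k Z j. 1)"
      unfolding M_def count_image_mset' by (intro sum.cong) auto
    then show ?thesis by (simp add: eq_commute[of T])
  qed
  \<comment> \<open>The number of empty columns is what the nonempty ones leave of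
    \<open>n\<close>.\<close>
  have split_M: "M Z = filter_mset (\<lambda>T. T \<noteq> {}) (M Z) + replicate_mset (n - size (filter_mset (\<lambda>T. T \<noteq> {}) (M Z))) {}" for Z
  proof -
    have "M Z = filter_mset (\<lambda>T. T \<noteq> {}) (M Z) + filter_mset (\<lambda>T. T = {}) (M Z)"
      using multiset_partition[of "M Z" "\<lambda>T. T \<noteq> {}"] by simp
    also have "filter_mset (\<lambda>T. T = {}) (M Z) = replicate_mset (count (M Z) {}) {}"
      by (rule filter_eq_replicate_mset)
    finally have eq: "M Z = filter_mset (\<lambda>T. T \<noteq> {}) (M Z) + replicate_mset (count (M Z) {}) {}" .
    have "n = size (M Z)" by (simp add: M_def)
    also have "\<dots> = size (filter_mset (\<lambda>T. T \<noteq> {}) (M Z)) + count (M Z) {}"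
      using arg_cong[OF eq, of size] by (simp only: size_union size_replicate_mset)
    finally have diff: "n - size (filter_mset (\<lambda>T. T \<noteq> {}) (M Z)) = count (M Z) {}" by simp
    show ?thesis unfolding diff by (rule eq)
  qed
  have "count (M X) T = count (M X') T" if "T \<noteq> {}" for T
    unfolding count_M card_owners_eq[OF X(1) k that] card_owners_eq[OF X(2) k that] ..
  then have "filter_mset (\<lambda>T. T \<noteq> {}) (M X) = filter_mset (\<lambda>T. T \<noteq> {}) (M X')"
    by (intro multiset_eqI) simp
  then have "M X = M X'" by (subst split_M[of X], subst split_M[of X']) (simp only:)
  then have eq: "image_mset (owners k X) (mset_set {0..<n}) = image_mset (owners k X') (mset_set {0..<n})"
    by (simp add: M_def)
  obtain \<rho> where \<rho>: "\<rho> permutes {0..<n}" and own: "\<forall>j\<in>{0..<n}. owners k X j = owners k X' (\<rho> j)"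
    by (rule image_mset_eq_implies_permutes[OF _ eq]) auto
  have "X' i = \<rho> ` X i" for i
  proof (cases "i < k")
    case True
    have sub: "X i \<subseteq> {0..<n}" "X' i \<subseteq> {0..<n}"
      using X Fs_subset_inputs True by (force simp: inputs_def)+
    have mem: "j \<in> X i \<longleftrightarrow> \<rho> j \<in> X' i" if "j \<in> {0..<n}" for j
    proof -
      have "i \<in> owners k X j \<longleftrightarrow> i \<in> owners k X' (\<rho> j)" using own that by simp
      then show ?thesis using True by (simp add: owners_def)
    qed
    show ?thesis
    proof (intro set_eqI iffI)
      fix j assume j: "j \<in> X' i"
      then have "j \<in> \<rho> ` {0..<n}" using sub permutes_image[OF \<rho>] by auto
      then show "j \<in> \<rho> ` X i" using j mem by auto
    qed (use sub mem in auto)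
  next
    case False
    then show ?thesis using X Fs_subset_inputs by (force simp: inputs_def)
  qed
  then show ?thesis using that[OF \<rho>] by (auto simp: relabel_def fun_eq_iff)
qed

text \<open>By transitivity the sum over relabellings is the same for every member of the class, and
  each relabelling permutes the class. Counting pairs of a member and a relabelling in two ways
  gives the average.\<close>

lemma orbit_average:
  fixes g :: "(nat \<Rightarrow> nat set) \<Rightarrow> real"
  assumes Z: "Z \<in> Fs b k n s" and k: "k \<ge> 2"
  shows "(\<Sum>\<sigma> | \<sigma> permutes {0..<n}. g (relabel \<sigma> Z)) =
    fact n * ((\<Sum>X\<in>Fs b k n s. g X) / real (card (Fs b k n s)))"
proof -
  let ?S = "{\<sigma>. \<sigma> permutes {0..<n}}" and ?F = "Fs b k n s"
  have const: "(\<Sum>\<sigma>\<in>?S. g (relabel \<sigma> X)) = (\<Sum>\<sigma>\<in>?S. g (relabel \<sigma> Z))" if X: "X \<in> ?F" for X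
  proof -
    obtain \<rho> where \<rho>: "\<rho> permutes {0..<n}" "X = relabel \<rho> Z"
      using Fs_transitive[OF Z X k] .
    have "(\<Sum>\<sigma>\<in>?S. g (relabel \<sigma> Z)) = (\<Sum>\<sigma>\<in>?S. g (relabel (\<sigma> \<circ> \<rho>) Z))"
      by (rule sum_permutations_compose_right[OF \<rho>(1)])
    then show ?thesis by (simp add: \<rho>(2) relabel_def image_comp comp_assoc)
  qed
  have bij: "(\<Sum>X\<in>?F. g (relabel \<sigma> X)) = (\<Sum>X\<in>?F. g X)" if \<sigma>: "\<sigma> permutes {0..<n}" for \<sigma>
  proof -
    have "inj_on (relabel \<sigma>) ?F"
      using permutes_inj[OF \<sigma>]
      by (intro inj_onI) (auto simp: relabel_def fun_eq_iff inj_image_eq_iff)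
    moreover have "relabel \<sigma> ` ?F \<subseteq> ?F" using relabel_Fs[OF \<sigma>] by auto
    ultimately have "bij_betw (relabel \<sigma>) ?F ?F"
      unfolding bij_betw_def by (simp add: endo_inj_surj)
    then show ?thesis by (rule sum.reindex_bij_betw)
  qed
  have "real (card ?F) * (\<Sum>\<sigma>\<in>?S. g (relabel \<sigma> Z)) = (\<Sum>X\<in>?F. \<Sum>\<sigma>\<in>?S. g (relabel \<sigma> X))"
    using const by simp
  also have "\<dots> = (\<Sum>\<sigma>\<in>?S. \<Sum>X\<in>?F. g (relabel \<sigma> X))" by (rule sum.swap)
  also have "\<dots> = real (card ?S) * (\<Sum>X\<in>?F. g X)" using bij by simp
  also have "card ?S = fact n" by (rule card_permutations) auto
  finally have "real (card ?F) * (\<Sum>\<sigma>\<in>?S. g (relabel \<sigma> Z)) = fact n * (\<Sum>X\<in>?F. g X)" by simp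
  moreover have "card ?F \<noteq> 0" using Z by auto
  ultimately show ?thesis by (simp add: field_simps)
qed

text \<open>The error is the mean over \<open>R\<close> of the errors of deterministic protocols, so
  some protocol in the support does no worse. This fixes the coins.\<close>

lemma deterministic_error:
  assumes "dist_error k n s R \<le> e"
  obtains P where "P \<in> set_pmf R"
    "(1/2) * (\<Sum>b\<in>UNIV. (\<Sum>X\<in>Fs b k n s. of_bool (run P X \<noteq> b)) / real (card (Fs b k n s))) \<le> e"
proof -
  define err :: "proto \<Rightarrow> real" where "err = (\<lambda>P. (1/2) * (\<Sum>b\<in>UNIV.
     (\<Sum>X\<in>Fs b k n s. indicator {P. run P X \<noteq> b} P) / real (card (Fs b k n s))))"
  have ind: "integrable (measure_pmf R) (indicat_real A)" for A
    by (rule measure_pmf.integrable_const_bound[of _ 1]) auto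
  have int: "integrable (measure_pmf R) err"
    unfolding err_def by (intro integrable_mult_right Bochner_Integration.integrable_sum
      Bochner_Integration.integrable_divide ind)
  have "dist_error k n s R = measure_pmf.expectation R err"
    unfolding err_def dist_error_def
    by (simp add: Bochner_Integration.integral_sum ind)
  have "\<exists>P\<in>set_pmf R. err P \<le> e"
  proof (rule ccontr)
    assume "\<not> ?thesis"
    then have "AE P in measure_pmf R. e < err P" by (auto simp: AE_measure_pmf_iff)
    then have "e < measure_pmf.expectation R err"
      by (intro measure_pmf.expectation_greater int)
    then show False using assms \<open>dist_error k n s R = _\<close> by simp
  qed
  then obtain P where P: "P \<in> set_pmf R" "err P \<le> e" by auto
  have "err P = (1/2) * (\<Sum>b\<in>UNIV. (\<Sum>X\<in>Fs b k n s. of_bool (run P X \<noteq> b)) / real (card (Fs b k n s)))"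
    unfolding err_def by (simp add: indicator_def of_bool_def)
  with P that show ?thesis by simp
qed

section \<open>The planted distribution\<close>

text \<open>With \<open>V\<close> as output, one of the two masses on each \<open>w\<close> is error
  mass: \<open>a w\<close> if \<open>V w\<close>, otherwise \<open>b w\<close>. AM-GM with weight 10
  on the error mass and \<open>1/10\<close> on the other bounds the cross term of the
  square.\<close>

lemma hellinger_ge_error:
  fixes a b :: "'l \<Rightarrow> real"
  assumes nonneg: "\<And>w. 0 \<le> a w" "\<And>w. 0 \<le> b w" and total: "(\<Sum>w\<in>L. a w) = 1" "(\<Sum>w\<in>L. b w) = 1"
  shows "9/5 - 10 * ((\<Sum>w\<in>L. of_bool (V w) * a w) + (\<Sum>w\<in>L. of_bool (\<not> V w) * b w))
    \<le> (\<Sum>w\<in>L. (sqrt (b w) - sqrt (a w))\<^sup>2)"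
proof -
  have amgm: "2 * (sqrt x * sqrt y) \<le> 10 * x + y / 10" if "0 \<le> x" "0 \<le> y" for x y :: real
  proof -
    have "0 \<le> 10 * (sqrt x - sqrt y / 10)\<^sup>2" by simp
    then show ?thesis using that by (simp add: power2_diff power_divide field_simps)
  qed
  have "9/5 - 10 * ((\<Sum>w\<in>L. of_bool (V w) * a w) + (\<Sum>w\<in>L. of_bool (\<not> V w) * b w)) =
    (\<Sum>w\<in>L. 9/10 * a w + 9/10 * b w - 10 * (of_bool (V w) * a w + of_bool (\<not> V w) * b w))"
    by (simp only: sum.distrib sum_subtractf sum_distrib_left[symmetric] total)
  also have "\<dots> \<le> (\<Sum>w\<in>L. (sqrt (b w) - sqrt (a w))\<^sup>2)"
  proof (rule sum_mono)
    fix w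
    have "(sqrt (b w) - sqrt (a w))\<^sup>2 = b w + a w - 2 * (sqrt (a w) * sqrt (b w))"
      using nonneg by (simp add: power2_diff)
    then show "9/10 * a w + 9/10 * b w - 10 * (of_bool (V w) * a w + of_bool (\<not> V w) * b w)
        \<le> (sqrt (b w) - sqrt (a w))\<^sup>2"
      using amgm[of "a w" "b w"] amgm[of "b w" "a w"] nonneg[of w]
      by (cases "V w") (simp_all add: mult.commute)
  qed
  finally show ?thesis .
qed

lemma prob_agrees_reindex:
  assumes h: "bij_betw h A B" and \<phi>: "\<And>y. y \<in> A \<Longrightarrow> \<phi> y = \<psi> (h y)"
  shows "prob_agrees P \<phi> A i w = prob_agrees P \<psi> B i w"
proof -
  have "bij_betw h {y \<in> A. agrees P w i (\<phi> y)} {y \<in> B. agrees P w i (\<psi> y)}"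
    using h \<phi> unfolding bij_betw_def by (auto simp: inj_on_def)
  then show ?thesis
    using bij_betw_same_card[OF h] by (simp add: prob_agrees_def bij_betw_same_card)
qed

text \<open>Player \<open>i\<close> holds one point of each of \<open>s i\<close> disjoint pairs
  \<open>e i l True, e i l False\<close>. The pairs of different players are disjoint except that the points
  \<open>e i 0 True\<close> coincide, so the player's bit is whether it takes the shared point.\<close>

locale layout =
  fixes k n :: nat and s :: "nat \<Rightarrow> nat" and e :: "nat \<Rightarrow> nat \<Rightarrow> bool \<Rightarrow> nat"
  assumes k: "2 \<le> k" and s: "\<And>i. i < k \<Longrightarrow> 1 \<le> s i"
    and e_less: "\<And>i l b. i < k \<Longrightarrow> l < s i \<Longrightarrow> e i l b < n"
    and e_eq: "\<And>i l b i' l' b'. i < k \<Longrightarrow> l < s i \<Longrightarrow> i' < k \<Longrightarrow> l' < s i' \<Longrightarrow>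
      e i l b = e i' l' b' \<longleftrightarrow> l = l' \<and> b = b' \<and> (i = i' \<or> l = 0 \<and> b)"

text \<open>Here the bound on the set sizes enters: the \<open>2 * (\<Sum>i<k. s i)\<close> labels
  inject into \<open>{0..<n}\<close>, and then all labels \<open>(i, 0, True)\<close> are redirected
  to one point.\<close>

lemma exists_layout:
  assumes "2 \<le> k" "\<And>i. i < k \<Longrightarrow> 1 \<le> s i" "2 * (\<Sum>i<k. s i) \<le> n"
  obtains e where "layout k n s e"
proof -
  define E where "E = (SIGMA i:{..<k}. {..<s i} \<times> (UNIV :: bool set))"
  have "card E = (\<Sum>i<k. s i * 2)"
    unfolding E_def by (subst card_SigmaI) (auto simp: card_cartesian_product)
  then have "card E \<le> card {0..<n}" using assms(3) by (simp add: sum_distrib_left mult.commute)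
  moreover have "finite E" by (auto simp: E_def)
  ultimately obtain g where g: "g ` E \<subseteq> {0..<n}" "inj_on g E"
    using card_le_inj[of E "{0..<n}"] by auto
  define e where "e = (\<lambda>i l b. if l = 0 \<and> b then g (0, 0, True) else g (i, l, b))"
  have E: "(i, l, b) \<in> E" if "i < k" "l < s i" for i l b using that by (simp add: E_def)
  have E0: "(0, 0, True) \<in> E" using assms(1) assms(2)[of 0] by (simp add: E_def)
  have g_less: "g x < n" if "x \<in> E" for x using g(1) that by auto
  have "e i l b < n" if "i < k" "l < s i" for i l b
    using g_less[OF E[OF that]] g_less[OF E0] by (simp add: e_def)
  moreover have "e i l b = e i' l' b' \<longleftrightarrow> l = l' \<and> b = b' \<and> (i = i' \<or> l = 0 \<and> b)"
    if "i < k" "l < s i" "i' < k" "l' < s i'" for i l b i' l' b'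
    using E[OF that(1,2)] E[OF that(3,4)] E0 inj_on_eq_iff[OF g(2)]
    by (auto simp: e_def)
  ultimately have "layout k n s e" using assms(1,2) by unfold_locales
  then show ?thesis by (rule that)
qed

text \<open>The set \<open>y\<close> of pairs from which the \<open>True\<close> point is taken
  codes a choice as a point of the cube of dimension \<open>s i\<close>.\<close>

definition pick :: "(nat \<Rightarrow> nat) \<Rightarrow> (nat \<Rightarrow> nat \<Rightarrow> bool \<Rightarrow> nat) \<Rightarrow> nat \<Rightarrow> nat set \<Rightarrow> nat set" where
  "pick s e i y = (\<lambda>l. e i l (l \<in> y)) ` {..<s i}"

text \<open>Coordinate \<open>0\<close> carries the bit of the player; the other coordinates are
  free.\<close>

definition picks :: "(nat \<Rightarrow> nat) \<Rightarrow> nat \<Rightarrow> bool \<Rightarrow> nat set set" where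
  "picks s i b = {y \<in> Pow {..<s i}. (0 \<in> y) = b}"

lemma finite_picks [simp]: "finite (picks s i b)"
  by (simp add: picks_def)

context layout
begin

lemma pick_subset: "i < k \<Longrightarrow> pick s e i y \<subseteq> {0..<n}"
  using e_less by (auto simp: pick_def)

lemma card_pick:
  assumes "i < k"
  shows "card (pick s e i y) = s i"
proof -
  have "inj_on (\<lambda>l. e i l (l \<in> y)) {..<s i}"
    using assms by (intro inj_onI) (simp add: e_eq)
  then show ?thesis by (simp add: pick_def card_image)
qed

lemma input_of_relabel:
  "input_of k (\<lambda>i y. \<sigma> ` pick s e i y) Y = relabel \<sigma> (input_of k (pick s e) Y)"
  by (simp add: input_of_def relabel_def fun_eq_iff)

lemma input_of_pick_inputs: "input_of k (pick s e) Y \<in> inputs k n"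
  using pick_subset by (auto simp: inputs_def input_of_def)

text \<open>Two players can have only the point \<open>e 0 0 True\<close> in common. Nobody holds it
  when all bits are false, everybody when all are true.\<close>

lemma input_of_pick_Fs:
  assumes Y: "Y \<in> PiE {..<k} (\<lambda>i. picks s i b)"
  shows "input_of k (pick s e) Y \<in> Fs b k n s"
proof -
  let ?X = "input_of k (pick s e) Y"
  let ?c = "e 0 0 True"
  have bit: "0 \<in> Y i \<longleftrightarrow> b" if "i < k" for i
    using Y that by (auto simp: PiE_iff picks_def)
  have c: "e i 0 True = ?c" if "i < k" for i
    using e_eq[of i 0 0 0 True True] that s[of i] s[of 0] by auto
  have shared: "i = i' \<or> b \<and> j = ?c"
    if i: "i < k" "i' < k" and j: "j \<in> ?X i" "j \<in> ?X i'" for i i' j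
  proof -
    obtain l where l: "l < s i" "j = e i l (l \<in> Y i)"
      using i j by (auto simp: input_of_def pick_def)
    obtain l' where l': "l' < s i'" "j = e i' l' (l' \<in> Y i')"
      using i j by (auto simp: input_of_def pick_def)
    have "i = i' \<or> l = 0 \<and> l \<in> Y i"
      using e_eq[OF i(1) l(1) i(2) l'(1)] l(2) l'(2) by metis
    then show ?thesis using l(2) bit[OF i(1)] c[OF i(1)] by auto
  qed
  have col: "col k ?X j \<le> 1" if "\<not> (b \<and> j = ?c)" for j
    unfolding col_def One_nat_def
    by (subst card_le_Suc0_iff_eq) (use shared that in auto)
  have "?X \<in> (if b then F1 k n else F0 k n)"
  proof (cases b)
    case True
    have "?c \<in> ?X i" if "i < k" for i
      using that bit[OF that] c[OF that] s[OF that] True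
      by (auto simp: input_of_def pick_def intro!: image_eqI[of _ _ 0])
    then have "{i \<in> {0..<k}. ?c \<in> ?X i} = {0..<k}" by auto
    then have "col k ?X ?c = k" by (simp add: col_def)
    moreover have "?c < n" using k s[of 0] e_less[of 0 0 True] by simp
    ultimately show ?thesis using True col input_of_pick_inputs by (auto simp: F1_def)
  next
    case False
    then show ?thesis using col input_of_pick_inputs by (simp add: F0_def)
  qed
  moreover have "card (?X i) = s i" if "i < k" for i
    using that by (simp add: input_of_def card_pick)
  ultimately show ?thesis by (simp add: Fs_def)
qed

section \<open>Exchangeability of the pairs of one player\<close>

definition swap_pair :: "nat \<Rightarrow> nat \<Rightarrow> nat \<Rightarrow> nat" where
  "swap_pair i l = Transposition.transpose (e i 0 True) (e i l True) \<circ> Transposition.transpose (e i 0 False) (e i l False)"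

lemma swap_pair_permutes:
  assumes "i < k" "l < s i"
  shows "swap_pair i l permutes {0..<n}"
  unfolding swap_pair_def using assms s[of i] e_less[of i]
  by (intro permutes_compose permutes_swap_id) auto

lemma swap_pair_same:
  assumes "i < k" "l < s i" "l' < s i"
  shows "swap_pair i l (e i l' b) = e i (Transposition.transpose 0 l l') b"
  using assms s[of i] by (cases b) (auto simp: swap_pair_def Transposition.transpose_def e_eq)

text \<open>Of the points that are moved, another player can own only the shared one, and that case
  is excluded.\<close>

lemma swap_pair_other:
  assumes "i < k" "l < s i" "j < k" "j \<noteq> i" "l' < s j" "\<not> (l' = 0 \<and> b)"
  shows "swap_pair i l (e j l' b) = e j l' b"
  using assms s[of i] by (auto simp: swap_pair_def Transposition.transpose_def e_eq)

lemma swap_pair_pick_other: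
  assumes "i < k" "l < s i" "j < k" "j \<noteq> i" "0 \<notin> y"
  shows "swap_pair i l ` pick s e j y = pick s e j y"
  unfolding pick_def image_image
  using assms by (intro image_cong refl swap_pair_other) auto

text \<open>Pairs are exchanged with \<open>True\<close> going to \<open>True\<close> and
  \<open>False\<close> to \<open>False\<close>, so the effect is an exchange of two coordinates of
  \<open>y\<close>.\<close>

lemma swap_pair_pick_same:
  assumes "i < k" "l < s i"
  shows "swap_pair i l ` pick s e i y = pick s e i (Transposition.transpose 0 l ` y)"
proof -
  have perm: "Transposition.transpose 0 l permutes {..<s i}"
    using assms s[of i] by (intro permutes_swap_id) auto
  have "swap_pair i l ` pick s e i y = (\<lambda>l'. e i (Transposition.transpose 0 l l') (l' \<in> y)) ` {..<s i}"
    unfolding pick_def image_image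
    using assms by (intro image_cong refl swap_pair_same) auto
  also have "\<dots> = (\<lambda>l'. e i (Transposition.transpose 0 l l') (Transposition.transpose 0 l l' \<in> Transposition.transpose 0 l ` y)) ` {..<s i}"
    by (simp add: inj_image_mem_iff)
  also have "\<dots> = (\<lambda>l'. e i l' (l' \<in> Transposition.transpose 0 l ` y)) ` (Transposition.transpose 0 l ` {..<s i})"
    by (simp only: image_image)
  also have "Transposition.transpose 0 l ` {..<s i} = {..<s i}" by (rule permutes_image[OF perm])
  finally show ?thesis by (simp add: pick_def)
qed

lemma swap_picks_bij:
  assumes "i < k" "l < s i"
  shows "bij_betw (image (Transposition.transpose 0 l)) (picks s i b) {y \<in> Pow {..<s i}. (l \<in> y) = b}"
proof (rule bij_betw_byWitness[where f' = "image (Transposition.transpose 0 l)"])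
  have perm: "Transposition.transpose 0 l permutes {..<s i}"
    using assms s[of i] by (intro permutes_swap_id) auto
  have sub: "Transposition.transpose 0 l ` y \<subseteq> {..<s i} \<longleftrightarrow> y \<subseteq> {..<s i}" for y
    using permutes_in_image[OF perm] by auto
  have mem: "l \<in> Transposition.transpose 0 l ` y \<longleftrightarrow> 0 \<in> y" "0 \<in> Transposition.transpose 0 l ` y \<longleftrightarrow> l \<in> y" for y
    using inj_image_mem_iff[OF inj_transpose, of 0 l 0 y] inj_image_mem_iff[OF inj_transpose, of 0 l l y]
    by auto
  show "image (Transposition.transpose 0 l) ` picks s i b \<subseteq> {y \<in> Pow {..<s i}. (l \<in> y) = b}"
    by (rule image_subsetI) (simp add: picks_def sub mem)
  show "image (Transposition.transpose 0 l) ` {y \<in> Pow {..<s i}. (l \<in> y) = b} \<subseteq> picks s i b"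
    by (rule image_subsetI) (simp add: picks_def sub mem)
qed (auto simp: image_image)

section \<open>Transcript distances in the planted distribution\<close>

definition prob_pick :: "proto \<Rightarrow> (nat \<Rightarrow> nat) \<Rightarrow> nat \<Rightarrow> bool \<Rightarrow> bool list \<Rightarrow> real" where
  "prob_pick P \<sigma> i b = prob_agrees P (\<lambda>y. \<sigma> ` pick s e i y) (picks s i b) i"

text \<open>Twice the squared Hellinger distance between the transcript distributions in which
  exactly the players in \<open>B\<close> have bit 1 and in which none has.\<close>

definition hellinger :: "proto \<Rightarrow> (nat \<Rightarrow> nat) \<Rightarrow> nat set \<Rightarrow> real" where
  "hellinger P \<sigma> B = (\<Sum>w\<in>live k P. (sqrt (\<Prod>i<k. prob_pick P \<sigma> i (i \<in> B) w) -
    sqrt (\<Prod>i<k. prob_pick P \<sigma> i False w))\<^sup>2)"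

lemma prob_pick_nonneg: "0 \<le> prob_pick P \<sigma> i b w"
  by (simp add: prob_pick_def)

lemma picks_nonempty: "i < k \<Longrightarrow> picks s i b \<noteq> {}"
proof -
  assume "i < k"
  then have "(if b then {0} else {}) \<in> picks s i b" using s[of i] by (auto simp: picks_def)
  then show ?thesis by auto
qed

lemma sum_prod_prob_pick: "(\<Sum>w\<in>live k P. \<Prod>i<k. prob_pick P \<sigma> i (B i) w) = 1"
  unfolding prob_pick_def
  by (rule sum_live_prod_prob_agrees_one) (simp_all add: picks_nonempty)

lemma hellinger_all_le: "hellinger P \<sigma> {..<k} \<le> 9 * (\<Sum>i<k. hellinger P \<sigma> {i})"
  unfolding hellinger_def using k
  by (intro cut_and_paste) (auto simp: prob_pick_nonneg sum_prod_prob_pick)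

text \<open>The other players contribute the same factor to both probabilities, and it comes out of
  the square.\<close>

lemma hellinger_singleton:
  assumes "i < k"
  shows "hellinger P \<sigma> {i} = (\<Sum>w\<in>live k P. (\<Prod>j\<in>{..<k} - {i}. prob_pick P \<sigma> j False w) *
    (sqrt (prob_pick P \<sigma> i True w) - sqrt (prob_pick P \<sigma> i False w))\<^sup>2)"
  unfolding hellinger_def
proof (intro sum.cong refl)
  fix w
  define q where "q = (\<Prod>j\<in>{..<k} - {i}. prob_pick P \<sigma> j False w)"
  have q: "0 \<le> q" unfolding q_def by (intro prod_nonneg) (simp add: prob_pick_nonneg)
  have "(\<Prod>j<k. prob_pick P \<sigma> j (j \<in> B) w) = prob_pick P \<sigma> i (i \<in> B) w * q" if "B \<subseteq> {i}" for B
  proof -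
    have "(\<Prod>j\<in>{..<k} - {i}. prob_pick P \<sigma> j (j \<in> B) w) = q"
      unfolding q_def
    proof (intro prod.cong refl)
      fix j assume "j \<in> {..<k} - {i}"
      then have "j \<notin> B" using that by auto
      then show "prob_pick P \<sigma> j (j \<in> B) w = prob_pick P \<sigma> j False w" by simp
    qed
    then show ?thesis using assms by (subst prod.remove[of _ i]) auto
  qed
  from this[of "{i}"] this[of "{}"]
  have "(\<Prod>j<k. prob_pick P \<sigma> j (j \<in> {i}) w) = prob_pick P \<sigma> i True w * q"
    "(\<Prod>j<k. prob_pick P \<sigma> j False w) = prob_pick P \<sigma> i False w * q" by simp_all
  then show "(sqrt (\<Prod>j<k. prob_pick P \<sigma> j (j \<in> {i}) w) - sqrt (\<Prod>j<k. prob_pick P \<sigma> j False w))\<^sup>2 =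
    q * (sqrt (prob_pick P \<sigma> i True w) - sqrt (prob_pick P \<sigma> i False w))\<^sup>2"
    using q by (simp only: real_sqrt_mult left_diff_distrib[symmetric] power_mult_distrib)
      (simp add: mult.commute)
qed

text \<open>Composing with \<open>swap_pair i l\<close> moves the bit of player \<open>i\<close> to
  coordinate \<open>l\<close> and leaves the others alone, since their bits are 0. All
  \<open>s i\<close> terms thus belong to one setting in which player \<open>i\<close> draws from
  the whole cube, and \<open>sum_hellinger_le_communication\<close> bounds them together.\<close>

lemma sum_hellinger_swap_pair_le:
  assumes i: "i < k" and \<sigma>: "\<sigma> permutes {0..<n}" and P: "bounded k n C P"
  shows "(\<Sum>l<s i. hellinger P (\<sigma> \<circ> swap_pair i l) {i}) \<le> 8 * real (C i)"
proof -
  define A where "A = (\<lambda>j. if j = i then Pow {..<s i} else picks s j False)"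
  define \<phi> where "\<phi> = (\<lambda>j y. \<sigma> ` pick s e j y)"
  define p where "p = (\<lambda>l b. prob_agrees P (\<phi> i) {y \<in> Pow {..<s i}. (l \<in> y) = b} i)"
  have other: "prob_pick P (\<sigma> \<circ> swap_pair i l) j False w = prob_agrees P (\<phi> j) (A j) j w"
    if "j < k" "j \<noteq> i" "l < s i" for j l w
    unfolding prob_pick_def
  proof (rule prob_agrees_reindex[where h = id])
    show "(\<sigma> \<circ> swap_pair i l) ` pick s e j y = \<phi> j (id y)" if "y \<in> picks s j False" for y
    proof -
      have "0 \<notin> y" using that by (simp add: picks_def)
      then show ?thesis
        by (simp only: image_comp[symmetric] \<phi>_def id_apply
          swap_pair_pick_other[OF i \<open>l < s i\<close> \<open>j < k\<close> \<open>j \<noteq> i\<close> \<open>0 \<notin> y\<close>])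
    qed
  qed (simp add: A_def \<open>j \<noteq> i\<close>)
  have same: "prob_pick P (\<sigma> \<circ> swap_pair i l) i b w = p l b w" if "l < s i" for l b w
    unfolding prob_pick_def p_def
  proof (rule prob_agrees_reindex[where h = "image (Transposition.transpose 0 l)"])
    show "(\<sigma> \<circ> swap_pair i l) ` pick s e i y = \<phi> i (Transposition.transpose 0 l ` y)" for y
      by (simp only: image_comp[symmetric] \<phi>_def swap_pair_pick_same[OF i that])
  qed (rule swap_picks_bij[OF i that])
  have "(\<Sum>l<s i. hellinger P (\<sigma> \<circ> swap_pair i l) {i}) =
    (\<Sum>l<s i. \<Sum>w\<in>live k P. (\<Prod>j\<in>{..<k} - {i}. prob_agrees P (\<phi> j) (A j) j w) *
      (sqrt (p l True w) - sqrt (p l False w))\<^sup>2)"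
    using i by (intro sum.cong refl) (simp add: hellinger_singleton same other)
  also have "\<dots> \<le> 8 * real (C i)"
    unfolding p_def
  proof (rule sum_hellinger_le_communication[OF i])
    show "finite (A j)" for j by (simp add: A_def)
    show "A j \<noteq> {}" if "j < k" for j
      using picks_nonempty[OF that] by (auto simp: A_def)
    show "A i = Pow {..<s i}" by (simp add: A_def)
    show "bits P (input_of k \<phi> Y) i \<le> C i" for Y
    proof -
      have "input_of k \<phi> Y \<in> inputs k n"
        unfolding \<phi>_def input_of_relabel by (intro relabel_inputs \<sigma> input_of_pick_inputs)
      then show ?thesis using P i unfolding bounded_def by (metis (full_types))
    qed
  qed
  finally show ?thesis .
qed

text \<open>Composition with \<open>swap_pair i l\<close> permutes the relabellings, so the
  \<open>s i\<close> terms have equal sums over \<sigma>, each an \<open>s i\<close>-th of the joint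
  bound.\<close>

lemma sum_hellinger_singleton_le:
  assumes i: "i < k" and P: "bounded k n C P"
  shows "(\<Sum>\<sigma> | \<sigma> permutes {0..<n}. hellinger P \<sigma> {i}) \<le> fact n * (8 * (real (C i) / real (s i)))"
proof -
  let ?S = "{\<sigma>. \<sigma> permutes {0..<n}}"
  have "real (s i) * (\<Sum>\<sigma>\<in>?S. hellinger P \<sigma> {i}) = (\<Sum>l<s i. \<Sum>\<sigma>\<in>?S. hellinger P \<sigma> {i})" by simp
  also have "\<dots> = (\<Sum>l<s i. \<Sum>\<sigma>\<in>?S. hellinger P (\<sigma> \<circ> swap_pair i l) {i})"
    using swap_pair_permutes[OF i] by (intro sum.cong refl sum_permutations_compose_right) auto
  also have "\<dots> = (\<Sum>\<sigma>\<in>?S. \<Sum>l<s i. hellinger P (\<sigma> \<circ> swap_pair i l) {i})" by (rule sum.swap)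
  also have "\<dots> \<le> (\<Sum>\<sigma>\<in>?S. 8 * real (C i))"
    by (intro sum_mono sum_hellinger_swap_pair_le i P) auto
  also have "\<dots> = fact n * (8 * real (C i))"
    using card_permutations[of "{0..<n}" n] by simp
  finally show ?thesis using s[OF i] by (simp add: field_simps)
qed

text \<open>Every planted input with all bits \<open>b\<close> lies in \<open>Fs b k n s\<close>,
  and a random relabelling makes any member of this class uniform on it. The averaged planted error
  is therefore the conditional error given \<open>b\<close>.\<close>

lemma sum_error_eq:
  "(\<Sum>\<sigma> | \<sigma> permutes {0..<n}. \<Sum>w\<in>live k P. of_bool (verdict P w \<noteq> b) * (\<Prod>i<k. prob_pick P \<sigma> i b w)) =
    fact n * ((\<Sum>X\<in>Fs b k n s. of_bool (run P X \<noteq> b)) / real (card (Fs b k n s)))"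
proof -
  let ?S = "{\<sigma>. \<sigma> permutes {0..<n}}" and ?Y = "PiE {..<k} (\<lambda>i. picks s i b)"
  define err where "err = (\<Sum>X\<in>Fs b k n s. of_bool (run P X \<noteq> b)) / real (card (Fs b k n s))"
  have "finite ?Y" "?Y \<noteq> {}"
    using picks_nonempty by (auto intro!: finite_PiE simp: PiE_eq_empty_iff)
  then have pos: "card ?Y \<noteq> 0" by simp
  have "(\<Sum>\<sigma>\<in>?S. \<Sum>w\<in>live k P. of_bool (verdict P w \<noteq> b) * (\<Prod>i<k. prob_pick P \<sigma> i b w)) =
    (\<Sum>\<sigma>\<in>?S. (\<Sum>Y\<in>?Y. of_bool (run P (relabel \<sigma> (input_of k (pick s e) Y)) \<noteq> b)) / real (card ?Y))"
    unfolding prob_pick_def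
    by (subst sum_live_prod_prob_agrees[where \<phi> = "\<lambda>i y. _ i ` pick s e i y"]) 
      (simp_all add: verdict_transcript input_of_relabel)
  also have "\<dots> = (\<Sum>Y\<in>?Y. \<Sum>\<sigma>\<in>?S. of_bool (run P (relabel \<sigma> (input_of k (pick s e) Y)) \<noteq> b)) / real (card ?Y)"
    unfolding sum_divide_distrib[symmetric] by (subst sum.swap) (rule refl)
  also have "\<dots> = (\<Sum>Y\<in>?Y. fact n * err) / real (card ?Y)"
    unfolding err_def
    by (intro arg_cong2[where f = "(/)"] sum.cong refl orbit_average input_of_pick_Fs k)
  also have "\<dots> = fact n * err" using pos by simp
  finally show ?thesis unfolding err_def .
qed

section \<open>Comparison of the lower and upper bounds on the distance\<close>

lemma communication_bound:
  assumes P: "bounded k n C P"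
    and err: "(1/2) * (\<Sum>b\<in>UNIV. (\<Sum>X\<in>Fs b k n s. of_bool (run P X \<noteq> b)) / real (card (Fs b k n s))) \<le> 1/100"
  shows "1/50 \<le> (\<Sum>i<k. real (C i) / real (s i))"
proof -
  let ?S = "{\<sigma>. \<sigma> permutes {0..<n}}"
  define T where "T = (\<Sum>i<k. real (C i) / real (s i))"
  define er where "er = (\<lambda>b. (\<Sum>X\<in>Fs b k n s. of_bool (run P X \<noteq> b)) / real (card (Fs b k n s)))"
  define E where "E = (\<lambda>\<sigma> b. \<Sum>w\<in>live k P. of_bool (verdict P w \<noteq> b) * (\<Prod>i<k. prob_pick P \<sigma> i b w))"
  have card_S: "real (card ?S) = fact n" using card_permutations[of "{0..<n}" n] by simp
  have er: "er False + er True \<le> 1/50"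
  proof -
    have "(1/2) * (\<Sum>b\<in>UNIV. er b) \<le> 1/100" using err unfolding er_def .
    then show ?thesis by (simp add: UNIV_bool)
  qed
  have E_sum: "(\<Sum>\<sigma>\<in>?S. E \<sigma> b) = fact n * er b" for b
    unfolding E_def er_def by (rule sum_error_eq)
  have low: "9/5 - 10 * (E \<sigma> False + E \<sigma> True) \<le> hellinger P \<sigma> {..<k}" for \<sigma>
  proof -
    have "hellinger P \<sigma> {..<k} = (\<Sum>w\<in>live k P. (sqrt (\<Prod>i<k. prob_pick P \<sigma> i True w) -
      sqrt (\<Prod>i<k. prob_pick P \<sigma> i False w))\<^sup>2)" unfolding hellinger_def by simp
    then show ?thesis
      using hellinger_ge_error[of "\<lambda>w. \<Prod>i<k. prob_pick P \<sigma> i False w"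
        "\<lambda>w. \<Prod>i<k. prob_pick P \<sigma> i True w" "live k P" "verdict P"]
      by (simp add: E_def prod_nonneg prob_pick_nonneg sum_prod_prob_pick)
  qed
  \<comment> \<open>A total error of at most \<open>1/50\<close> takes \<open>10 * (1/50)\<close>
    away from \<open>9/5\<close>.\<close>
  have "fact n * (8/5) \<le> fact n * (9/5) - 10 * (fact n * (er False + er True))"
  proof -
    have "fact n * (er False + er True) \<le> fact n * (1/50)"
      by (intro mult_left_mono er) auto
    then show ?thesis by simp
  qed
  also have "\<dots> = (\<Sum>\<sigma>\<in>?S. 9/5 - 10 * (E \<sigma> False + E \<sigma> True))"
    by (simp only: sum_subtractf sum_distrib_left[symmetric] sum.distrib E_sum sum_constant card_S
        distrib_left)
  also have "\<dots> \<le> (\<Sum>\<sigma>\<in>?S. 9 * (\<Sum>i<k. hellinger P \<sigma> {i}))"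
    by (intro sum_mono order_trans[OF low hellinger_all_le])
  also have "\<dots> = 9 * (\<Sum>i<k. \<Sum>\<sigma>\<in>?S. hellinger P \<sigma> {i})"
    unfolding sum_distrib_left[symmetric] by (subst sum.swap) (rule refl)
  also have "\<dots> \<le> 9 * (\<Sum>i<k. fact n * (8 * (real (C i) / real (s i))))"
    by (intro mult_left_mono sum_mono sum_hellinger_singleton_le P) auto
  also have "\<dots> = fact n * (72 * T)" by (simp add: T_def sum_distrib_left mult_ac)
  \<comment> \<open>The factor 72 is 9 from merging times 8 from the level-one bound. Hence
    \<open>T\<close> is at least \<open>1/45\<close>, which exceeds \<open>1/50\<close>.\<close>
  finally have "8/5 \<le> 72 * T" by (simp add: mult_le_cancel_left)
  then show ?thesis by (simp add: T_def)
qed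

end

theorem mainTheorem8:
  shows "\<exists>c::real. c > 0 \<and>
    (\<forall>k n (s::nat \<Rightarrow> nat) (C::nat \<Rightarrow> nat) (R::proto pmf).
       k \<ge> 2 \<longrightarrow> n \<ge> 1 \<longrightarrow> (\<forall>i<k. s i \<ge> 1) \<longrightarrow> 2 * (\<Sum>i<k. s i) \<le> n \<longrightarrow>
       (\<forall>P\<in>set_pmf R. bounded k n C P) \<longrightarrow>
       dist_error k n s R \<le> 1/100 \<longrightarrow>
       (\<Sum>i<k. real (C i) / real (s i)) \<ge> c)"
proof (intro exI[of _ "1/50"] conjI allI impI)
  fix k n :: nat and s C :: "nat \<Rightarrow> nat" and R :: "proto pmf"
  assume k: "k \<ge> 2" and s: "\<forall>i<k. s i \<ge> 1" "2 * (\<Sum>i<k. s i) \<le> n"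
    and R: "\<forall>P\<in>set_pmf R. bounded k n C P" and err: "dist_error k n s R \<le> 1/100"
  obtain P where P: "P \<in> set_pmf R" "(1/2) * (\<Sum>b\<in>UNIV.
      (\<Sum>X\<in>Fs b k n s. of_bool (run P X \<noteq> b)) / real (card (Fs b k n s))) \<le> 1/100"
    using deterministic_error[OF err] .
  obtain e where "layout k n s e"
    using exists_layout[of k s n] k s by blast
  then show "1/50 \<le> (\<Sum>i<k. real (C i) / real (s i))"
    using P R by (intro layout.communication_bound) auto
qed simp

end
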